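(* Let $N\ge3$ and $V(x)=\sum_{i=1}^k\frac{\lambda_i\chi_{B(a_i,r_i)}(x)}{|x-a_i|^2}+\frac{\lambda_\infty\chi_{\mathbb{R}^N\setminus B(0,R)}(x)}{|x|^2}+W(x)\in\mathcal{V}$, where $W\in L^\infty(\mathbb{R}^N)$ and $W(x)=O(|x|^{-2-\delta})$ as $|x|\to\infty$ for some $\delta>0$. Assume $\mu(V)>0$. Let $\gamma_\infty\in\mathbb{R}$ with $\lambda_\infty+\gamma_\infty<\left(\frac{N-2}{2}\right)^2$. Then there exists $\tilde R>R$ such that $\mu\!\left(V+\frac{\gamma_\infty}{|x|^2}\chi_{\mathbb{R}^N\setminus B(0,\tilde R)}\right)>0$, i.e. the quadratic form associated with $-\Delta-V-\frac{\gamma_\infty}{|x|^2}\chi_{\mathbb{R}^N\setminus B(0,\tilde R)}$ is positive definite on $\mathcal{D}^{1,2}(\mathbb{R}^N)$.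
   Context: $\mathcal{D}^{1,2}(\mathbb{R}^N)$ is the completion of $C_c^\infty(\mathbb{R}^N)$ for the norm $(\int|\nabla u|^2)^{1/2}$. The class $\mathcal{V}$ consists of all functions $V(x)=\sum_{i=1}^k\frac{\lambda_i\chi_{B(a_i,r_i)}(x)}{|x-a_i|^2}+\frac{\lambda_\infty\chi_{\mathbb{R}^N\setminus B(0,R)}(x)}{|x|^2}+W(x)$ with $k\in\mathbb{N}$, $r_i,R>0$, $a_i$ pairwise distinct, $\lambda_i,\lambda_\infty<\frac{(N-2)^2}{4}$, $W\in L^{N/2}(\mathbb{R}^N)\cap L^\infty(\mathbb{R}^N)$. For a potential $U$, $\mu(U)=\inf_{u\in\mathcal{D}^{1,2}(\mathbb{R}^N)\setminus\{0\}}\frac{\int(|\nabla u|^2-Uu^2)}{\int|\nabla u|^2}$; positive definite means $\int|\nabla u|^2-\int Uu^2\ge\varepsilon\int|\nabla u|^2$ for some $\varepsilon>0$ and all $u$. *)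

theory Defs
  imports "HOL-Analysis.Analysis"
begin

fun Ck :: "nat \<Rightarrow> ('a::euclidean_space \<Rightarrow> real) \<Rightarrow> bool" where
  "Ck 0 f = continuous_on UNIV f"
| "Ck (Suc k) f = ((\<forall>x. f differentiable (at x)) \<and> continuous_on UNIV f \<and>
      (\<forall>i\<in>Basis. Ck k (\<lambda>x. frechet_derivative f (at x) i)))"

definition smooth :: "('a::euclidean_space \<Rightarrow> real) \<Rightarrow> bool" where
  "smooth f \<longleftrightarrow> (\<forall>k. Ck k f)"

definition Cc_inf :: "('a::euclidean_space \<Rightarrow> real) set" where
  "Cc_inf = {f. smooth f \<and> compact (closure {x. f x \<noteq> 0})}"

definition grad :: "('a::euclidean_space \<Rightarrow> real) \<Rightarrow> 'a \<Rightarrow> 'a" where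
  "grad f x = (\<Sum>i\<in>Basis. frechet_derivative f (at x) i *\<^sub>R i)"

definition crit_exp :: "'a::euclidean_space itself \<Rightarrow> real" where
  "crit_exp _ = 2 * real DIM('a) / (real DIM('a) - 2)"

(* D^{1,2}(R^N), the completion of C_c^\<infinity> under the norm (\<integral>|\<nabla>u|^2)^{1/2}, realised
   (via the Sobolev inequality) as pairs (u, g) where u is the L^{2*}-limit and g the
   L^2-limit of the gradients of a sequence in C_c^\<infinity> that is Cauchy in that norm;
   g is the (weak) gradient of u. *)
definition D12 :: "(('a::euclidean_space \<Rightarrow> real) \<times> ('a \<Rightarrow> 'a)) set" where
  "D12 = {(u, g). u \<in> borel_measurable lebesgue \<and> g \<in> borel_measurable lebesgue \<and>
     (\<exists>\<phi>::nat \<Rightarrow> 'a \<Rightarrow> real. (\<forall>n. \<phi> n \<in> Cc_inf) \<and>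
        (\<lambda>n. \<integral>\<^sup>+ x. ennreal ((norm (grad (\<phi> n) x - g x))\<^sup>2) \<partial>lebesgue) \<longlonglongrightarrow> 0 \<and>
        (\<lambda>n. \<integral>\<^sup>+ x. ennreal (\<bar>\<phi> n x - u x\<bar> powr crit_exp TYPE('a)) \<partial>lebesgue) \<longlonglongrightarrow> 0)}"

definition Dnorm2 :: "('a::euclidean_space \<Rightarrow> 'a) \<Rightarrow> real" where
  "Dnorm2 g = (\<integral>x. (norm (g x))\<^sup>2 \<partial>lebesgue)"

definition mu :: "('a::euclidean_space \<Rightarrow> real) \<Rightarrow> real" where
  "mu U = Inf {(Dnorm2 g - (\<integral>x. U x * (u x)\<^sup>2 \<partial>lebesgue)) / Dnorm2 g
               | u g. (u, g) \<in> D12 \<and> Dnorm2 g \<noteq> 0}"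

definition in_Lp :: "real \<Rightarrow> ('a::euclidean_space \<Rightarrow> real) \<Rightarrow> bool" where
  "in_Lp p W \<longleftrightarrow> W \<in> borel_measurable lebesgue \<and>
     (\<integral>\<^sup>+ x. ennreal (\<bar>W x\<bar> powr p) \<partial>lebesgue) < \<infinity>"

definition in_Linf :: "('a::euclidean_space \<Rightarrow> real) \<Rightarrow> bool" where
  "in_Linf W \<longleftrightarrow> W \<in> borel_measurable lebesgue \<and> (\<exists>C. AE x in lebesgue. \<bar>W x\<bar> \<le> C)"

definition Vpot :: "nat \<Rightarrow> (nat \<Rightarrow> 'a::euclidean_space) \<Rightarrow> (nat \<Rightarrow> real) \<Rightarrow> (nat \<Rightarrow> real)
                     \<Rightarrow> real \<Rightarrow> real \<Rightarrow> ('a \<Rightarrow> real) \<Rightarrow> 'a \<Rightarrow> real" where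
  "Vpot k a r lam lam_inf R W x =
     (\<Sum>i<k. lam i * indicator (ball (a i) (r i)) x / (norm (x - a i))\<^sup>2)
     + lam_inf * indicator (- ball 0 R) x / (norm x)\<^sup>2 + W x"

end

theory Submission
  imports Defs
begin

text \<open>By Hardy's inequality every potential in play is form bounded with respect to the Dirichlet
  integral, so by density the quadratic forms need only be compared on \<open>C\<^sub>c\<^sup>\<infinity>\<close>. There the
  localisation \<open>sin\<^sup>2 b + cos\<^sup>2 b = 1\<close> splits \<open>\<phi>\<close> into a piece \<open>(sin b) \<phi>\<close>, to which \<open>\<mu>(V) > 0\<close> applies,
  and a piece \<open>(cos b) \<phi>\<close> living far out, where \<open>V\<close> and the new term are together at most \<open>\<Lambda>/\<bar>x\<bar>\<^sup>2\<close> with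
  \<open>\<Lambda> < ((N - 2)/2)\<^sup>2\<close>, so that Hardy's inequality applies. The localisation error
  \<open>\<integral>\<phi>\<^sup>2 \<bar>\<nabla>b\<bar>\<^sup>2\<close> is absorbed by Hardy's inequality as well, since the angle \<open>b\<close> can be chosen with
  \<open>\<bar>\<nabla>b\<bar>\<^sup>2 \<le> \<eta>/\<bar>x\<bar>\<^sup>2\<close> for any \<open>\<eta> > 0\<close>. Because \<open>\<phi>\<close> has compact support, \<open>b\<close> need not be
  eventually constant: it is enough that \<open>cos\<^sup>2 b \<le> \<eta>\<close> near the singularities and \<open>sin\<^sup>2 b \<le> \<eta>\<close>
  outside \<open>B(0, R')\<close>.\<close>

section \<open>Smooth functions\<close>

text \<open>Uniqueness of the derivative replaces the choice \<open>frechet_derivative\<close>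
  inside \<open>Ck\<close> by an explicit \<open>f'\<close>. Most closure properties below then
  become inductions on \<open>k\<close>.\<close>

lemma Ck_SucI:
  assumes "\<And>x. (f has_derivative f' x) (at x)" and "\<And>i. i \<in> Basis \<Longrightarrow> Ck k (\<lambda>x. f' x i)"
  shows "Ck (Suc k) f"
proof -
  have "frechet_derivative f (at x) = f' x" for x
    using frechet_derivative_at[OF assms(1)] by metis
  moreover have "f differentiable (at x)" for x
    using assms(1) differentiable_def by blast
  moreover have "continuous_on UNIV f"
    using assms(1) by (meson continuous_at_imp_continuous_on has_derivative_continuous)
  ultimately show ?thesis using assms(2) by simp
qed

lemma Ck_has_derivative:
  "Ck (Suc k) f \<Longrightarrow> (f has_derivative frechet_derivative f (at x)) (at x)"
  by (simp add: frechet_derivative_works)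

lemma Ck_SucD: "Ck (Suc k) f \<Longrightarrow> Ck k f"
  by (induction k arbitrary: f) auto

lemma Ck_const: "Ck k (\<lambda>x. c)"
proof (induction k arbitrary: c)
  case (Suc k) then show ?case by (intro Ck_SucI[where f'="\<lambda>x h. 0"]) auto
qed simp

lemma Ck_inner: "Ck k (\<lambda>x. x \<bullet> b)"
proof (cases k)
  case 0 then show ?thesis by (auto intro!: continuous_intros)
next
  case (Suc j)
  then show ?thesis
    by (auto intro!: Ck_SucI[where f'="\<lambda>x h. h \<bullet> b"] derivative_eq_intros Ck_const simp del: Ck.simps)
qed

lemma Ck_add: "Ck k f \<Longrightarrow> Ck k g \<Longrightarrow> Ck k (\<lambda>x. f x + g x)"
proof (induction k arbitrary: f g)
  case (Suc k)
  show ?case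
    by (rule Ck_SucI[OF has_derivative_add[OF Suc.prems[THEN Ck_has_derivative]]])
      (use Suc in auto)
qed (auto intro: continuous_intros)

lemma Ck_mult: "Ck k f \<Longrightarrow> Ck k g \<Longrightarrow> Ck k (\<lambda>x. f x * g x)"
proof (induction k arbitrary: f g)
  case (Suc k)
  show ?case
    by (rule Ck_SucI[OF has_derivative_mult[OF Suc.prems[THEN Ck_has_derivative]]],
        intro Ck_add Suc.IH)
      (use Suc.prems Ck_SucD in \<open>auto simp del: Ck.simps(1)\<close>)
qed (auto intro: continuous_intros)

lemma Ck_sum: "finite I \<Longrightarrow> (\<And>i. i \<in> I \<Longrightarrow> Ck k (f i)) \<Longrightarrow> Ck k (\<lambda>x. \<Sum>i\<in>I. f i x)"
  by (induction I rule: finite_induct) (auto intro: Ck_const Ck_add)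

text \<open>The exponent is generalised in the induction because differentiation lowers it to
  \<open>c - 1\<close>. Positivity of \<open>f\<close> keeps away from the singular point of
  \<open>powr\<close>.\<close>

lemma Ck_powr:
  fixes f :: "'a::euclidean_space \<Rightarrow> real"
  shows "Ck k f \<Longrightarrow> (\<And>x. f x > 0) \<Longrightarrow> Ck k (\<lambda>x. f x powr c)"
proof (induction k arbitrary: c)
  case 0
  have "f x \<noteq> 0" for x using 0(2)[of x] by simp
  then show ?case using 0(1) by (simp add: continuous_on_powr)
next
  case (Suc k)
  let ?f' = "\<lambda>x h. c * (f x powr (c - 1) * frechet_derivative f (at x) h)"
  have d: "((\<lambda>x. f x powr c) has_derivative ?f' x) (at x)" for x
  proof -
    have "((\<lambda>t. t powr c) has_real_derivative c * f x powr (c - 1)) (at (f x))"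
      using Suc.prems(2) by (rule has_real_derivative_powr)
    from has_derivative_compose[OF Ck_has_derivative[OF Suc.prems(1)] this[unfolded has_field_derivative_def]]
    show ?thesis by (simp add: mult.assoc)
  qed
  show ?case
  proof (rule Ck_SucI[OF d])
    fix i :: 'a assume "i \<in> Basis"
    then show "Ck k (\<lambda>x. ?f' x i)"
      using Suc.IH[OF Ck_SucD[OF Suc.prems(1)] Suc.prems(2)] Suc.prems(1)
      by (intro Ck_mult Ck_const) auto
  qed
qed

text \<open>The derivative of each function contains the other one, so both are treated in a single
  induction.\<close>

lemma Ck_sin_cos:
  fixes f :: "'a::euclidean_space \<Rightarrow> real"
  shows "Ck k f \<Longrightarrow> Ck k (\<lambda>x. sin (f x)) \<and> Ck k (\<lambda>x. cos (f x))"
proof (induction k)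
  case 0
  then show ?case by (auto intro!: continuous_intros)
next
  case (Suc k)
  note IH = Suc.IH[OF Ck_SucD[OF Suc.prems]]
  have ds: "((\<lambda>x. sin (f x)) has_derivative (\<lambda>h. cos (f x) * frechet_derivative f (at x) h)) (at x)" for x
    by (rule derivative_eq_intros Ck_has_derivative[OF Suc.prems] refl | simp add: mult.commute)+
  have dc: "((\<lambda>x. cos (f x)) has_derivative (\<lambda>h. - 1 * (sin (f x) * frechet_derivative f (at x) h))) (at x)" for x
    by (rule derivative_eq_intros Ck_has_derivative[OF Suc.prems] refl | simp add: mult.commute)+
  have p: "Ck k (\<lambda>x. frechet_derivative f (at x) i)" if "i \<in> Basis" for i
    using Suc.prems that by simp
  show ?case
    by (intro conjI Ck_SucI[OF ds] Ck_SucI[OF dc] Ck_mult Ck_const p IH[THEN conjunct1] IH[THEN conjunct2])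
qed

section \<open>Smooth functions and their gradients\<close>

lemma smooth_mult: "smooth f \<Longrightarrow> smooth g \<Longrightarrow> smooth (\<lambda>x. f x * g x)"
  by (simp add: smooth_def Ck_mult)

lemma smooth_diff: "smooth f \<Longrightarrow> smooth g \<Longrightarrow> smooth (\<lambda>x. f x - g x)"
  using Ck_add[of _ f "\<lambda>x. (-1) * g x"] Ck_mult[of _ "\<lambda>x. -1" g] 
  by (simp add: smooth_def Ck_const)

text \<open>A linear form is determined by its values on \<open>Basis\<close>, hence is the inner
  product with the vector of these values. All later gradient computations go through this form and
  \<open>grad_eqI\<close>.\<close>

lemma smooth_has_derivative:
  assumes "smooth f"
  shows "(f has_derivative (\<lambda>h. grad f x \<bullet> h)) (at x)"
proof -
  have f: "(f has_derivative frechet_derivative f (at x)) (at x)"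
    using assms Ck_has_derivative[of 0 f] unfolding smooth_def by blast
  then interpret linear "frechet_derivative f (at x)" by (rule has_derivative_linear)
  have "frechet_derivative f (at x) h = grad f x \<bullet> h" for h
  proof -
    have "frechet_derivative f (at x) h = frechet_derivative f (at x) (\<Sum>i\<in>Basis. (h \<bullet> i) *\<^sub>R i)"
      by (simp only: euclidean_representation)
    then show ?thesis
      unfolding sum scale grad_def inner_sum_left inner_scaleR_left
      by (simp add: inner_commute mult.commute)
  qed
  then show ?thesis using f by presburger
qed

lemma grad_eqI:
  assumes "(f has_derivative (\<lambda>h. v \<bullet> h)) (at x)"
  shows "grad f x = v"
  unfolding grad_def frechet_derivative_at[OF assms, symmetric] by (rule euclidean_representation)

lemma smooth_continuous_grad:
  assumes "smooth f"
  shows "continuous_on UNIV (grad f)"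
proof -
  have "Ck 1 f" using assms by (simp add: smooth_def)
  then show ?thesis unfolding grad_def by (auto intro!: continuous_intros simp: One_nat_def)
qed

lemma smooth_continuous: "smooth f \<Longrightarrow> continuous_on UNIV f"
  using smooth_def[of f] Ck.simps(1)[of f] by blast

lemma grad_mult:
  assumes "smooth f" "smooth g"
  shows "grad (\<lambda>x. f x * g x) x = f x *\<^sub>R grad g x + g x *\<^sub>R grad f x"
  by (rule grad_eqI)
    (auto intro!: derivative_eq_intros smooth_has_derivative assms simp: algebra_simps)

lemma grad_diff:
  assumes "smooth f" "smooth g"
  shows "grad (\<lambda>x. f x - g x) x = grad f x - grad g x"
  by (rule grad_eqI)
    (auto intro!: derivative_eq_intros smooth_has_derivative assms simp: algebra_simps)

section \<open>Test functions and integration by parts\<close>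

lemma integrable_lebesgue_continuous:
  fixes f :: "'a::euclidean_space \<Rightarrow> 'b::euclidean_space"
  assumes c: "continuous_on UNIV f" and z: "\<And>x. norm x \<ge> B \<Longrightarrow> f x = 0"
  shows "integrable lebesgue f"
proof -
  have "integrable lborel (\<lambda>x. indicator (cball 0 B) x *\<^sub>R f x)"
    using c continuous_on_subset by (intro borel_integrable_compact) auto
  also have "(\<lambda>x. indicator (cball 0 B) x *\<^sub>R f x) = f"
  proof
    fix x show "indicator (cball 0 B) x *\<^sub>R f x = f x"
      using z[of x] by (cases "norm x \<le> B") auto
  qed
  finally show ?thesis
    by (rule integrable_completion[THEN iffD2, rotated]) (simp add: borel_measurable_continuous_onI c)
qed

lemma integral_lebesgue_translate:
  fixes f :: "'a::euclidean_space \<Rightarrow> real"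
  assumes "f \<in> borel_measurable borel"
  shows "(\<integral>x. f (x + c) \<partial>lebesgue) = (\<integral>x. f x \<partial>lebesgue)"
proof -
  have m: "f \<in> borel_measurable lborel" "(\<lambda>x. f (x + c)) \<in> borel_measurable lborel"
    using assms by measurable
  have "(\<integral>x. f x \<partial>lborel) = (\<integral>x. f x \<partial>distr lborel borel ((+) c))"
    by (simp add: lborel_distr_plus)
  also have "\<dots> = (\<integral>x. f (c + x) \<partial>lborel)"
    using assms by (intro integral_distr) auto
  finally show ?thesis using m by (simp add: integral_completion add.commute)
qed

lemma bounded_of_compact_support:
  fixes f :: "'a::euclidean_space \<Rightarrow> 'b::euclidean_space"
  assumes c: "continuous_on UNIV f" and z: "\<And>x. norm x \<ge> B \<Longrightarrow> f x = 0"
  obtains M where "\<And>x. norm (f x) \<le> M"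
proof -
  have "bounded (f ` cball 0 B)"
    by (intro compact_imp_bounded compact_continuous_image continuous_on_subset[OF c]) auto
  then obtain M where M: "\<And>x. norm x \<le> B \<Longrightarrow> norm (f x) \<le> M"
    unfolding bounded_iff by (metis image_eqI mem_cball_0)
  have "norm (f x) \<le> max M 0" for x
    using M[of x] z[of x] by (cases "norm x \<le> B") auto
  then show ?thesis using that by blast
qed

text \<open>By translation invariance the integrals of the difference quotients vanish.\<close>
lemma integral_directional_derivative_eq_0:
  fixes F :: "'a::euclidean_space \<Rightarrow> real"
  assumes d: "\<And>x. (F has_derivative (\<lambda>h. G x \<bullet> h)) (at x)"
    and G: "continuous_on UNIV G"
    and z: "\<And>x. norm x \<ge> B \<Longrightarrow> F x = 0" "\<And>x. norm x \<ge> B \<Longrightarrow> G x = 0"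
  shows "(\<integral>x. G x \<bullet> b \<partial>lebesgue) = 0"
proof -
  have F: "continuous_on UNIV F"
    using d by (meson continuous_at_imp_continuous_on has_derivative_continuous)
  then have Fm: "F \<in> borel_measurable borel" by (rule borel_measurable_continuous_onI)
  obtain M where M: "\<And>x. norm (G x) \<le> M" using bounded_of_compact_support[OF G z(2)] by blast
  have lip: "norm (F x - F y) \<le> M * norm (x - y)" for x y
  proof (rule differentiable_bound[OF convex_UNIV])
    show "onorm (\<lambda>h. G x \<bullet> h) \<le> M" for x
    proof (rule onorm_le)
      show "norm (G x \<bullet> h) \<le> M * norm h" for h
        using Cauchy_Schwarz_ineq2[of "G x" h] mult_right_mono[OF M[of x], of "norm h"] by simp
    qed
  qed (use d in auto)
  define D where "D n x = real (Suc n) * (F (x + (1 / real (Suc n)) *\<^sub>R b) - F x)" for n x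
  \<comment> \<open>The steps have length at most \<open>norm b\<close>, so the quotients vanish
    outside the ball of radius \<open>B + norm b\<close>; inside it the Lipschitz constant
    \<open>M\<close> bounds them by \<open>M * norm b\<close>.\<close>
  define w where "w = (\<lambda>x::'a. M * norm b * indicator (cball 0 (B + norm b)) x)"
  have shift: "(\<lambda>x. F (x + c)) \<in> borel_measurable borel" for c
    using Fm by measurable
  have Dm: "D n \<in> borel_measurable lebesgue" for n
    unfolding D_def using shift Fm
    by (intro borel_measurable_times borel_measurable_diff borel_measurable_const measurable_completion) auto
  have intF: "integrable lebesgue F" by (rule integrable_lebesgue_continuous[OF F z(1)])
  have intFc: "integrable lebesgue (\<lambda>x. F (x + c))" for c
  proof (rule integrable_lebesgue_continuous)
    show "continuous_on UNIV (\<lambda>x. F (x + c))"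
      by (intro continuous_on_compose2[OF F] continuous_intros) auto
    show "F (x + c) = 0" if "norm x \<ge> B + norm c" for x
      using norm_triangle_ineq4[of "x + c" c] that by (intro z(1)) simp
  qed
  have "integral\<^sup>L lebesgue (D n) = 0" for n
    unfolding D_def using integral_lebesgue_translate[OF Fm] intF intFc by simp
  moreover have "(\<lambda>n. integral\<^sup>L lebesgue (D n)) \<longlonglongrightarrow> (\<integral>x. G x \<bullet> b \<partial>lebesgue)"
  proof (rule integral_dominated_convergence[where w=w])
    show "(\<lambda>x. G x \<bullet> b) \<in> borel_measurable lebesgue"
      by (intro measurable_completion) (auto intro!: borel_measurable_continuous_onI continuous_intros G)
    show "integrable lebesgue w" unfolding w_def
      by (intro integrable_mult_right integrable_real_indicator) (auto simp: emeasure_bounded_finite[unfolded infinity_ennreal_def])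
    show "AE x in lebesgue. (\<lambda>n. D n x) \<longlonglongrightarrow> G x \<bullet> b"
    proof (rule AE_I2)
      fix x
      have "((\<lambda>t. F (x + t *\<^sub>R b)) has_derivative (\<lambda>t. G x \<bullet> (t *\<^sub>R b))) (at 0)"
        by (rule has_derivative_compose[where g=F and f="\<lambda>t. x + t *\<^sub>R b" and f'="\<lambda>t. t *\<^sub>R b"])
          (auto intro!: derivative_eq_intros d)
      then have "((\<lambda>t. F (x + t *\<^sub>R b)) has_real_derivative (G x \<bullet> b)) (at 0)"
        by (simp add: has_field_derivative_def mult.commute[of _ "G x \<bullet> b"])
      then have "((\<lambda>t. (F (x + t *\<^sub>R b) - F x) / t) \<longlongrightarrow> G x \<bullet> b) (at 0)"
        by (simp add: DERIV_def)
      moreover have "filterlim (\<lambda>n. 1 / real (Suc n)) (at 0) sequentially"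
        unfolding filterlim_at using LIMSEQ_inverse_real_of_nat by (auto simp: inverse_eq_divide)
      ultimately show "(\<lambda>n. D n x) \<longlonglongrightarrow> G x \<bullet> b"
        unfolding D_def by (auto dest: filterlim_compose simp: field_simps)
    qed
    fix n
    show "AE x in lebesgue. norm (D n x) \<le> w x"
    proof (rule AE_I2)
      fix x
      let ?h = "(1 / real (Suc n)) *\<^sub>R b"
      show "norm (D n x) \<le> w x"
      proof (cases "norm x \<le> B + norm b")
        case True
        have "norm (D n x) = real (Suc n) * norm (F (x + ?h) - F x)"
          unfolding D_def by (simp add: abs_mult)
        also have "\<dots> \<le> real (Suc n) * (M * norm ?h)"
          using lip[of "x + ?h" x] by (intro mult_left_mono) auto
        also have "\<dots> = w x" using True by (simp add: w_def)
        finally show ?thesis .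
      next
        case False
        have "norm ?h \<le> norm b" by (simp add: divide_le_eq algebra_simps)
        moreover have "norm (x + ?h) \<ge> norm x - norm ?h" using norm_triangle_ineq4[of "x + ?h" ?h] by simp
        ultimately have "norm (x + ?h) \<ge> B" using False by linarith
        moreover have "norm x \<ge> B" using False norm_ge_zero[of b] by linarith
        ultimately show ?thesis using False z(1) by (simp add: D_def w_def)
      qed
    qed
  qed (use Dm in auto)
  ultimately show ?thesis by (simp add: LIMSEQ_const_iff)
qed

text \<open>The complement of the support is open, so near each of its points \<open>f\<close> is
  constantly 0 and the gradient vanishes too. One radius therefore serves for both.\<close>

lemma Cc_inf_support:
  assumes "f \<in> Cc_inf"
  obtains B where "\<forall>x. norm x \<ge> B \<longrightarrow> f x = 0 \<and> grad f x = 0"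
proof -
  define K where "K = closure {x. f x \<noteq> 0}"
  have closed_K: "closed K" by (simp add: K_def)
  have "bounded K" using assms compact_imp_bounded unfolding Cc_inf_def K_def by blast
  then obtain b where b: "\<And>x. x \<in> K \<Longrightarrow> norm x \<le> b" unfolding bounded_iff by blast
  have "{x. f x \<noteq> 0} \<subseteq> K" unfolding K_def by (rule closure_subset)
  then have f0: "f x = 0" if "x \<notin> K" for x using that by blast
  have "grad f x = 0" if "x \<notin> K" for x
  proof (rule grad_eqI)
    have "((\<lambda>x. 0) has_derivative (\<lambda>h. 0 \<bullet> h)) (at x)" by simp
    then show "(f has_derivative (\<lambda>h. 0 \<bullet> h)) (at x)"
      by (rule has_derivative_transform_within_open[of _ _ _ _ "- K"]) (use that f0 in \<open>auto simp: closed_K open_Compl\<close>)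
  qed
  moreover have "x \<notin> K" if "norm x \<ge> b + 1" for x
    using b[of x] that by (metis add_le_same_cancel1 not_one_le_zero order_trans)
  ultimately have "\<forall>x. norm x \<ge> b + 1 \<longrightarrow> f x = 0 \<and> grad f x = 0" using f0 by simp
  then show ?thesis by (rule that)
qed

lemma Cc_infI:
  assumes "smooth f" "\<And>x. norm x \<ge> B \<Longrightarrow> f x = 0"
  shows "f \<in> Cc_inf"
proof -
  have "norm x \<le> B" if "f x \<noteq> 0" for x using assms(2)[of x] that by linarith
  then have "{x. f x \<noteq> 0} \<subseteq> cball 0 B" by auto
  then show ?thesis
    using assms(1) bounded_subset[OF bounded_cball] unfolding Cc_inf_def by (simp add: compact_closure)
qed

lemma Cc_inf_smooth: "f \<in> Cc_inf \<Longrightarrow> smooth f"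
  by (simp add: Cc_inf_def)

text \<open>Compact support is asked of the second factor only. This is what permits a cutoff such
  as \<open>sin (b x)\<close> whose angle never becomes constant.\<close>

lemma Cc_inf_mult_left:
  assumes "smooth f" "g \<in> Cc_inf" shows "(\<lambda>x. f x * g x) \<in> Cc_inf"
proof -
  obtain B where "\<forall>x. norm x \<ge> B \<longrightarrow> g x = 0 \<and> grad g x = 0" using Cc_inf_support[OF assms(2)] by blast
  then show ?thesis by (intro Cc_infI[of _ B] smooth_mult[OF assms(1)] Cc_inf_smooth[OF assms(2)]) simp
qed

lemma Cc_inf_diff:
  assumes "f \<in> Cc_inf" "g \<in> Cc_inf" shows "(\<lambda>x. f x - g x) \<in> Cc_inf"
proof -
  obtain B where "\<forall>x. norm x \<ge> B \<longrightarrow> f x = 0 \<and> grad f x = 0" using Cc_inf_support[OF assms(1)] by blast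
  moreover obtain B' where "\<forall>x. norm x \<ge> B' \<longrightarrow> g x = 0 \<and> grad g x = 0" using Cc_inf_support[OF assms(2)] by blast
  ultimately have "f x - g x = 0" if "norm x \<ge> max B B'" for x using that by simp
  then show ?thesis by (intro Cc_infI[of _ "max B B'"] smooth_diff assms[THEN Cc_inf_smooth]) simp
qed

lemma smooth_measurable:
  assumes "smooth f"
  shows "f \<in> borel_measurable borel" "f \<in> borel_measurable lebesgue"
    "grad f \<in> borel_measurable borel" "grad f \<in> borel_measurable lebesgue"
  using borel_measurable_continuous_onI[OF smooth_continuous[OF assms]]
    borel_measurable_continuous_onI[OF smooth_continuous_grad[OF assms]]
  by (auto intro: measurable_completion)

lemma integrable_grad_square:
  assumes "f \<in> Cc_inf"
  shows "integrable lebesgue (\<lambda>x. (norm (grad f x))\<^sup>2)"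
proof -
  obtain B where "\<forall>x. norm x \<ge> B \<longrightarrow> f x = 0 \<and> grad f x = 0" using Cc_inf_support[OF assms] by blast
  moreover have "continuous_on UNIV (\<lambda>x. (norm (grad f x))\<^sup>2)"
    using smooth_continuous_grad[OF Cc_inf_smooth[OF assms]] by (intro continuous_on_power continuous_on_norm)
  ultimately show ?thesis by (intro integrable_lebesgue_continuous[where B=B]) auto
qed

section \<open>Hardy's inequality\<close>

text \<open>The regularisation \<open>q = \<bar>x - a\<bar>\<^sup>2 + e\<close> of the weight makes the vector field \<open>(x - a) / q\<close>
  smooth; its divergence is at least \<open>(N - 2) / q\<close>.\<close>
lemma hardy_regularised:
  fixes \<phi> :: "'a::euclidean_space \<Rightarrow> real"
  assumes N: "DIM('a) \<ge> 3" and \<phi>: "\<phi> \<in> Cc_inf" and e: "e > 0"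
  shows "integrable lebesgue (\<lambda>x. (\<phi> x)\<^sup>2 / ((norm (x - a))\<^sup>2 + e))" (is "integrable _ ?s")
    and "((real DIM('a) - 2) / 2)\<^sup>2 * (\<integral>x. (\<phi> x)\<^sup>2 / ((norm (x - a))\<^sup>2 + e) \<partial>lebesgue) \<le> Dnorm2 (grad \<phi>)"
proof -
  define q where "q x = (x - a) \<bullet> (x - a) + e" for x
  define t where "t = (real DIM('a) - 2) / 2"
  have t: "t \<ge> 0" using N by (simp add: t_def)
  have q: "q x > 0" for x using e by (simp add: q_def add_nonneg_pos)
  have q': "q x = (norm (x - a))\<^sup>2 + e" for x by (simp add: q_def power2_norm_eq_inner)
  have qnz: "q x \<noteq> 0" for x using q[of x] by simp
  have sm: "smooth \<phi>" using \<phi> by (rule Cc_inf_smooth)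
  note cont = smooth_continuous[OF sm] smooth_continuous_grad[OF sm]
  have cq: "continuous_on UNIV q" unfolding q_def by (intro continuous_intros)
  obtain B where B: "\<forall>x. norm x \<ge> B \<longrightarrow> \<phi> x = 0 \<and> grad \<phi> x = 0" using Cc_inf_support[OF \<phi>] by blast
  \<comment> \<open>\<open>F i\<close> is the component along \<open>i\<close> of the field
    \<open>(\<phi> x)^2 (x - a) / q x\<close>, and \<open>G i\<close> is its gradient.\<close>
  define F where "F i x = (\<phi> x)\<^sup>2 * ((x - a) \<bullet> i) / q x" for i x
  define G where "G i x = (2 * \<phi> x * ((x - a) \<bullet> i) / q x) *\<^sub>R grad \<phi> x + ((\<phi> x)\<^sup>2 / q x) *\<^sub>R i
      - (2 * (\<phi> x)\<^sup>2 * ((x - a) \<bullet> i) / (q x)\<^sup>2) *\<^sub>R (x - a)" for i x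
  have G: "continuous_on UNIV (G i)" for i
    unfolding G_def by (intro continuous_intros cont cq) (use qnz in auto)
  have dF: "(F i has_derivative (\<lambda>h. G i x \<bullet> h)) (at x)" for i x
  proof -
    have dq: "(q has_derivative (\<lambda>h. 2 * ((x - a) \<bullet> h))) (at x)"
      unfolding q_def by (auto intro!: derivative_eq_intros simp: inner_commute)
    have "((\<lambda>x. (\<phi> x)\<^sup>2 * ((x - a) \<bullet> i)) has_derivative
        (\<lambda>h. (\<phi> x)\<^sup>2 * (h \<bullet> i) + 2 * \<phi> x * (grad \<phi> x \<bullet> h) * ((x - a) \<bullet> i))) (at x)"
      by (auto intro!: derivative_eq_intros smooth_has_derivative[OF sm])
    from has_derivative_divide'[OF this dq qnz]
    have "(F i has_derivative (\<lambda>h. (((\<phi> x)\<^sup>2 * (h \<bullet> i) + 2 * \<phi> x * (grad \<phi> x \<bullet> h) * ((x - a) \<bullet> i)) * q x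
        - (\<phi> x)\<^sup>2 * ((x - a) \<bullet> i) * (2 * ((x - a) \<bullet> h))) / (q x * q x))) (at x)"
      by (simp add: F_def[abs_def])
    also have "(\<lambda>h. (((\<phi> x)\<^sup>2 * (h \<bullet> i) + 2 * \<phi> x * (grad \<phi> x \<bullet> h) * ((x - a) \<bullet> i)) * q x
        - (\<phi> x)\<^sup>2 * ((x - a) \<bullet> i) * (2 * ((x - a) \<bullet> h))) / (q x * q x)) = (\<lambda>h. G i x \<bullet> h)"
      using qnz[of x] unfolding G_def inner_add_left inner_diff_left[of "_ + _"] inner_scaleR_left
      by (intro ext) (simp add: inner_commute[of i] diff_divide_distrib add_divide_distrib power2_eq_square mult_ac)
    finally show ?thesis .
  qed
  have int0: "(\<integral>x. G i x \<bullet> i \<partial>lebesgue) = 0" for i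
    by (rule integral_directional_derivative_eq_0[OF dF G, of B]) (use B in \<open>auto simp: F_def G_def\<close>)
  have intG: "integrable lebesgue (\<lambda>x. G i x \<bullet> i)" for i
    by (rule integrable_lebesgue_continuous[of _ B])
      (use B in \<open>auto simp: G_def[of i] intro!: continuous_intros G[of i, unfolded G_def]\<close>)
  \<comment> \<open>\<open>S\<close> is the divergence of that field. It integrates to 0, being a
    sum of directional derivatives of compactly supported functions.\<close>
  define S where "S x = (\<Sum>i\<in>Basis. G i x \<bullet> i)" for x
  have S: "integrable lebesgue S" "(\<integral>x. S x \<partial>lebesgue) = 0"
    unfolding S_def using intG int0 by auto
  have S_eq: "S x = 2 * \<phi> x * (grad \<phi> x \<bullet> (x - a)) / q x + DIM('a) * (\<phi> x)\<^sup>2 / q x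
      - 2 * (\<phi> x)\<^sup>2 * ((x - a) \<bullet> (x - a)) / (q x)\<^sup>2" for x
  proof -
    define y where "y = x - a"
    show ?thesis
      unfolding S_def G_def y_def[symmetric] inner_add_left inner_diff_left[of "_ + _"] inner_scaleR_left
        sum.distrib sum_subtractf euclidean_inner[of y y] euclidean_inner[of "grad \<phi> x" y]
      by (simp add: sum_distrib_left sum_divide_distrib mult_ac)
  qed
  show ints: "integrable lebesgue ?s"
    unfolding q'[symmetric]
  proof (rule integrable_lebesgue_continuous[of _ B])
    show "continuous_on UNIV (\<lambda>x. (\<phi> x)\<^sup>2 / q x)"
      by (intro continuous_intros cont cq) (use qnz in auto)
  qed (use B in auto)
  have intg: "integrable lebesgue (\<lambda>x. (norm (grad \<phi> x))\<^sup>2)" by (rule integrable_grad_square[OF \<phi>])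
  have pw: "0 \<le> (norm (grad \<phi> x))\<^sup>2 - t\<^sup>2 * ?s x + t * S x" for x
  proof -
    define y where "y = x - a"
    define r where "r = y \<bullet> y / q x"
    define m where "m = (\<phi> x)\<^sup>2 / q x"
    have r: "r \<le> 1" unfolding r_def y_def using q[of x] e by (simp add: q_def)
    have m: "m \<ge> 0" using q[of x] by (simp add: m_def)
    \<comment> \<open>\<open>t\<close> is half of \<open>N - 2\<close>, the value for which the
      square and the divergence together leave exactly the coefficient \<open>t^2\<close>.\<close>
    have N2: "real DIM('a) = 2 * t + 2" by (simp add: t_def field_simps)
    have "0 \<le> (norm (grad \<phi> x + (t * \<phi> x / q x) *\<^sub>R y))\<^sup>2" by simp
    also have "\<dots> = (norm (grad \<phi> x))\<^sup>2 + 2 * t * \<phi> x * (grad \<phi> x \<bullet> y) / q x + t\<^sup>2 * (m * r)"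
      unfolding power2_norm_eq_inner m_def r_def inner_add_left inner_add_right inner_scaleR_left inner_scaleR_right
      by (simp add: power2_eq_square inner_commute algebra_simps)
    also have "\<dots> = (norm (grad \<phi> x))\<^sup>2 - t\<^sup>2 * m + t * S x - (2 * t + t\<^sup>2) * (m * (1 - r))"
      unfolding S_eq y_def[symmetric] N2 m_def r_def by (simp add: power2_eq_square algebra_simps add_divide_distrib diff_divide_distrib)
    also have "\<dots> \<le> (norm (grad \<phi> x))\<^sup>2 - t\<^sup>2 * m + t * S x"
      using t m r by simp
    finally show ?thesis by (simp add: m_def q')
  qed
  have "0 \<le> (\<integral>x. (norm (grad \<phi> x))\<^sup>2 - t\<^sup>2 * ?s x + t * S x \<partial>lebesgue)"
    by (rule integral_nonneg_AE) (use pw in simp)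
  also have "\<dots> = Dnorm2 (grad \<phi>) - t\<^sup>2 * (\<integral>x. ?s x \<partial>lebesgue) + t * (\<integral>x. S x \<partial>lebesgue)"
    unfolding Dnorm2_def
    by (subst Bochner_Integration.integral_add Bochner_Integration.integral_diff integral_mult_right_zero
        | intro Bochner_Integration.integrable_diff integrable_mult_right intg ints S refl)+
  finally show "((real DIM('a) - 2) / 2)\<^sup>2 * (\<integral>x. ?s x \<partial>lebesgue) \<le> Dnorm2 (grad \<phi>)"
    using S(2) by (simp add: t_def)
qed

lemma Dnorm2_nonneg: "Dnorm2 g \<ge> 0"
  by (simp add: Dnorm2_def)

text \<open>Fatou's lemma, with the regularisation \<open>1 / real (Suc n)\<close> tending to 0.
  Since the left side is an extended integral, integrability against the singular weight is part of
  the conclusion.\<close>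

lemma hardy_inequality:
  fixes \<phi> :: "'a::euclidean_space \<Rightarrow> real"
  assumes N: "DIM('a) \<ge> 3" and \<phi>: "\<phi> \<in> Cc_inf"
  shows "(\<integral>\<^sup>+x. ennreal ((\<phi> x)\<^sup>2 / (norm (x - a))\<^sup>2) \<partial>lebesgue)
    \<le> ennreal (Dnorm2 (grad \<phi>) / ((real DIM('a) - 2) / 2)\<^sup>2)"
proof -
  let ?H = "((real DIM('a) - 2) / 2)\<^sup>2"
  have H: "?H > 0" using N by simp
  let ?s = "\<lambda>n x. (\<phi> x)\<^sup>2 / ((norm (x - a))\<^sup>2 + 1 / real (Suc n))"
  note reg = hardy_regularised[OF N \<phi>, of "1 / real (Suc n)" a for n]
  have "(\<integral>\<^sup>+x. ennreal ((\<phi> x)\<^sup>2 / (norm (x - a))\<^sup>2) \<partial>lebesgue)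
      \<le> (\<integral>\<^sup>+x. liminf (\<lambda>n. ennreal (?s n x)) \<partial>lebesgue)"
  proof (rule nn_integral_mono)
    fix x
    show "ennreal ((\<phi> x)\<^sup>2 / (norm (x - a))\<^sup>2) \<le> liminf (\<lambda>n. ennreal (?s n x))"
    \<comment> \<open>At the pole division by zero makes the left side 0, so no limit has to be
      taken there.\<close>
    proof (cases "x = a")
      case False
      have "(\<lambda>n. ?s n x) \<longlonglongrightarrow> (\<phi> x)\<^sup>2 / ((norm (x - a))\<^sup>2 + 0)"
        using LIMSEQ_inverse_real_of_nat False
        by (intro tendsto_intros) (auto simp: inverse_eq_divide)
      then have "(\<lambda>n. ennreal (?s n x)) \<longlonglongrightarrow> ennreal ((\<phi> x)\<^sup>2 / (norm (x - a))\<^sup>2)"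
        by (auto intro: tendsto_ennrealI)
      then show ?thesis by (intro eq_refl lim_imp_Liminf[symmetric] sequentially_bot)
    qed simp
  qed
  also have "\<dots> \<le> liminf (\<lambda>n. \<integral>\<^sup>+x. ennreal (?s n x) \<partial>lebesgue)"
    using reg(1) by (intro nn_integral_liminf) (auto dest: borel_measurable_integrable)
  also have "\<dots> \<le> liminf (\<lambda>n::nat. ennreal (Dnorm2 (grad \<phi>) / ?H))"
  proof (intro Liminf_mono always_eventually allI)
    fix n
    have "(\<integral>\<^sup>+x. ennreal (?s n x) \<partial>lebesgue) = ennreal (\<integral>x. ?s n x \<partial>lebesgue)"
      using reg(1)[of n] by (intro nn_integral_eq_integral) auto
    also have "\<dots> \<le> ennreal (Dnorm2 (grad \<phi>) / ?H)"
      using reg(2)[of n] H by (intro ennreal_leI) (simp add: le_divide_eq mult.commute)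
    finally show "(\<integral>\<^sup>+x. ennreal (?s n x) \<partial>lebesgue) \<le> ennreal (Dnorm2 (grad \<phi>) / ?H)" .
  qed
  finally show ?thesis by (simp add: Liminf_const)
qed

section \<open>Form bounded potentials\<close>

text \<open>Rests on the bound of \<open>\<bar>f^2 - F^2\<bar>\<close> by
  \<open>(1 + 1/t) (f - F)^2 + t F^2\<close> for every \<open>t > 0\<close>. Later the weight
  \<open>s\<close> carries the sign of a potential, while the square root of its modulus is put into
  the functions.\<close>

lemma square_integral_tendsto:
  fixes f :: "nat \<Rightarrow> 'a \<Rightarrow> real"
  assumes [measurable]: "F \<in> borel_measurable M" "s \<in> borel_measurable M" 
    and s: "\<And>x. \<bar>s x\<bar> \<le> 1"
    and f: "\<And>n. f n \<in> borel_measurable M" "\<And>n. integrable M (\<lambda>x. (f n x)\<^sup>2)"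
    and lim: "(\<lambda>n. \<integral>\<^sup>+x. ennreal ((f n x - F x)\<^sup>2) \<partial>M) \<longlonglongrightarrow> 0"
  shows "integrable M (\<lambda>x. (F x)\<^sup>2)"
    and "(\<lambda>n. \<integral>x. s x * (f n x)\<^sup>2 \<partial>M) \<longlonglongrightarrow> (\<integral>x. s x * (F x)\<^sup>2 \<partial>M)"
proof -
  note [measurable] = f(1)
  define d where "d n = (\<integral>x. (f n x - F x)\<^sup>2 \<partial>M)" for n
  have ev: "\<forall>\<^sub>F n in sequentially. (\<integral>\<^sup>+x. ennreal ((f n x - F x)\<^sup>2) \<partial>M) < 1"
    using order_tendstoD(2)[OF lim, of 1] by simp
  then obtain n0 where "(\<integral>\<^sup>+x. ennreal ((f n0 x - F x)\<^sup>2) \<partial>M) < 1"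
    by (auto simp: eventually_sequentially)
  then have i0: "integrable M (\<lambda>x. (f n0 x - F x)\<^sup>2)"
    by (intro integrableI_nonneg) (auto intro: less_trans)
  show iF: "integrable M (\<lambda>x. (F x)\<^sup>2)"
  proof (rule Bochner_Integration.integrable_bound)
    show "integrable M (\<lambda>x. 2 * (f n0 x)\<^sup>2 + 2 * (f n0 x - F x)\<^sup>2)"
      using f(2) i0 by auto
    show "AE x in M. norm ((F x)\<^sup>2) \<le> norm (2 * (f n0 x)\<^sup>2 + 2 * (f n0 x - F x)\<^sup>2)"
    proof (rule AE_I2)
      fix x
      \<comment> \<open>Parallelogram law for \<open>f n0 x\<close> and \<open>f n0 x - F x\<close>;
        a single index at finite L2 distance from \<open>F\<close> is enough to make
        \<open>F\<close> square integrable.\<close>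
      have "(F x)\<^sup>2 + (2 * f n0 x - F x)\<^sup>2 = 2 * (f n0 x)\<^sup>2 + 2 * (f n0 x - F x)\<^sup>2"
        by (simp add: power2_eq_square algebra_simps)
      then have "(F x)\<^sup>2 \<le> 2 * (f n0 x)\<^sup>2 + 2 * (f n0 x - F x)\<^sup>2"
        using zero_le_power2[of "2 * f n0 x - F x"] by linarith
      then show "norm ((F x)\<^sup>2) \<le> norm (2 * (f n0 x)\<^sup>2 + 2 * (f n0 x - F x)\<^sup>2)"
        by simp
    qed
  qed simp
  have id: "integrable M (\<lambda>x. (f n x - F x)\<^sup>2)" for n
  proof (rule Bochner_Integration.integrable_bound)
    show "integrable M (\<lambda>x. 2 * (f n x)\<^sup>2 + 2 * (F x)\<^sup>2)"
      using f(2) iF by auto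
    show "AE x in M. norm ((f n x - F x)\<^sup>2) \<le> norm (2 * (f n x)\<^sup>2 + 2 * (F x)\<^sup>2)"
    proof (rule AE_I2)
      fix x
      have "(f n x - F x)\<^sup>2 + (f n x + F x)\<^sup>2 = 2 * (f n x)\<^sup>2 + 2 * (F x)\<^sup>2"
        by (simp add: power2_eq_square algebra_simps)
      then have "(f n x - F x)\<^sup>2 \<le> 2 * (f n x)\<^sup>2 + 2 * (F x)\<^sup>2"
        using zero_le_power2[of "f n x + F x"] by linarith
      then show "norm ((f n x - F x)\<^sup>2) \<le> norm (2 * (f n x)\<^sup>2 + 2 * (F x)\<^sup>2)"
        by simp
    qed
  qed simp
  have "(\<lambda>n. ennreal (d n)) \<longlonglongrightarrow> ennreal 0"
    using lim unfolding d_def by (simp add: nn_integral_eq_integral id)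
  then have d0: "d \<longlonglongrightarrow> 0"
    by (subst (asm) tendsto_ennreal_iff) (auto simp: d_def)
  define E where "E = (\<integral>x. (F x)\<^sup>2 \<partial>M)"
  have E: "E \<ge> 0" by (simp add: E_def)
  have isq: "integrable M (\<lambda>x. s x * (g x)\<^sup>2)" if "integrable M (\<lambda>x. (g x)\<^sup>2)" for g
  proof (rule Bochner_Integration.integrable_bound[OF that])
    show "(\<lambda>x. s x * (g x)\<^sup>2) \<in> borel_measurable M" using that by measurable
    show "AE x in M. norm (s x * (g x)\<^sup>2) \<le> norm ((g x)\<^sup>2)"
      using mult_right_mono[OF s] by (auto simp: abs_mult)
  qed
  have key: "\<bar>(\<integral>x. s x * (f n x)\<^sup>2 \<partial>M) - (\<integral>x. s x * (F x)\<^sup>2 \<partial>M)\<bar> \<le> (1 + 1 / t) * d n + t * E"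
    if t: "t > 0" for n t
  proof -
    have "\<bar>(\<integral>x. s x * (f n x)\<^sup>2 \<partial>M) - (\<integral>x. s x * (F x)\<^sup>2 \<partial>M)\<bar>
        = \<bar>\<integral>x. s x * (f n x)\<^sup>2 - s x * (F x)\<^sup>2 \<partial>M\<bar>"
      by (simp add: Bochner_Integration.integral_diff isq f(2) iF)
    also have "\<dots> \<le> (\<integral>x. (1 + 1 / t) * (f n x - F x)\<^sup>2 + t * (F x)\<^sup>2 \<partial>M)"
    proof (rule integral_abs_bound[THEN order_trans], rule integral_mono)
      fix x
      let ?d = "f n x - F x"
      have "0 \<le> (\<bar>?d\<bar> / sqrt t - sqrt t * \<bar>F x\<bar>)\<^sup>2" by simp
      also have "\<dots> = ?d\<^sup>2 / t + t * (F x)\<^sup>2 - 2 * \<bar>?d\<bar> * \<bar>F x\<bar>"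
        using t by (simp add: power2_diff power_divide power_mult_distrib)
      finally have "2 * \<bar>?d\<bar> * \<bar>F x\<bar> \<le> ?d\<^sup>2 / t + t * (F x)\<^sup>2" by simp
      moreover have "\<bar>(f n x)\<^sup>2 - (F x)\<^sup>2\<bar> \<le> ?d\<^sup>2 + 2 * \<bar>?d\<bar> * \<bar>F x\<bar>"
      proof -
        have "(f n x)\<^sup>2 - (F x)\<^sup>2 = ?d\<^sup>2 + 2 * ?d * F x" by (simp add: power2_eq_square algebra_simps)
        moreover have "\<bar>2 * ?d * F x\<bar> = 2 * \<bar>?d\<bar> * \<bar>F x\<bar>" by (simp only: abs_mult abs_numeral)
        ultimately show ?thesis using abs_triangle_ineq[of "?d\<^sup>2" "2 * ?d * F x"] by simp
      qed
      moreover have "\<bar>s x * (f n x)\<^sup>2 - s x * (F x)\<^sup>2\<bar> \<le> \<bar>(f n x)\<^sup>2 - (F x)\<^sup>2\<bar>"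
        using mult_right_mono[OF s, of "\<bar>(f n x)\<^sup>2 - (F x)\<^sup>2\<bar>" x]
        by (simp add: abs_mult right_diff_distrib[symmetric])
      ultimately show "\<bar>s x * (f n x)\<^sup>2 - s x * (F x)\<^sup>2\<bar> \<le> (1 + 1 / t) * ?d\<^sup>2 + t * (F x)\<^sup>2"
        by (simp add: algebra_simps)
    qed (use id iF isq f(2) in auto)
    also have "\<dots> = (1 + 1 / t) * d n + t * E" by (simp add: d_def E_def id iF)
    finally show ?thesis .
  qed
  show "(\<lambda>n. \<integral>x. s x * (f n x)\<^sup>2 \<partial>M) \<longlonglongrightarrow> (\<integral>x. s x * (F x)\<^sup>2 \<partial>M)"
  proof (rule LIMSEQ_I)
    fix e :: real assume e: "e > 0"
    \<comment> \<open>The choice makes the term \<open>t * E\<close> at most \<open>e / 2\<close>;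
      \<open>E + 1\<close> in place of \<open>E\<close> avoids a division by zero. With
      \<open>t\<close> fixed, the other term tends to 0.\<close>
    define t where "t = e / (2 * (E + 1))"
    have t: "t > 0" using e E by (simp add: t_def)
    have "t * E \<le> t * (E + 1)" using t by simp
    also have "\<dots> = e / 2" using E by (simp add: t_def field_simps)
    finally have tE: "t * E \<le> e / 2" .
    have "(\<lambda>n. (1 + 1 / t) * d n) \<longlonglongrightarrow> (1 + 1 / t) * 0" by (intro tendsto_intros d0)
    then have "\<forall>\<^sub>F n in sequentially. (1 + 1 / t) * d n < e / 2"
      using e by (intro order_tendstoD(2)) auto
    then obtain n1 where n1: "\<And>n. n \<ge> n1 \<Longrightarrow> (1 + 1 / t) * d n < e / 2"
      by (auto simp: eventually_sequentially)
    have "norm ((\<integral>x. s x * (f n x)\<^sup>2 \<partial>M) - (\<integral>x. s x * (F x)\<^sup>2 \<partial>M)) < e" if "n \<ge> n1" for n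
      using key[OF t, of n] n1[OF that] tE unfolding real_norm_def by linarith
    then show "\<exists>no. \<forall>n\<ge>no. norm ((\<integral>x. s x * (f n x)\<^sup>2 \<partial>M) - (\<integral>x. s x * (F x)\<^sup>2 \<partial>M)) < e" by blast
  qed
qed

text \<open>The powers \<open>\<bar>u n x\<bar> powr p\<close> tend to 0 in L1, so some subsequence
  of them tends to 0 almost everywhere, and powers with exponent \<open>1 / p\<close> lead back to
  \<open>u\<close>.\<close>

lemma nn_integral_powr_tendsto_AE_subseq:
  fixes u :: "nat \<Rightarrow> 'a \<Rightarrow> real"
  assumes p: "p > 0" and u [measurable]: "\<And>n. u n \<in> borel_measurable M"
    and lim: "(\<lambda>n. \<integral>\<^sup>+x. ennreal (\<bar>u n x\<bar> powr p) \<partial>M) \<longlonglongrightarrow> 0"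
  obtains r :: "nat \<Rightarrow> nat" where "strict_mono r" "AE x in M. (\<lambda>n. u (r n) x) \<longlonglongrightarrow> 0"
proof -
  have "\<forall>\<^sub>F n in sequentially. (\<integral>\<^sup>+x. ennreal (\<bar>u n x\<bar> powr p) \<partial>M) < 1"
    using order_tendstoD(2)[OF lim, of 1] by simp
  then obtain n0 where n0: "\<And>n. n \<ge> n0 \<Longrightarrow> (\<integral>\<^sup>+x. ennreal (\<bar>u n x\<bar> powr p) \<partial>M) < 1"
    by (auto simp: eventually_sequentially)
  \<comment> \<open>Only a tail of the sequence is known to have finite integrals. The shift by
    \<open>n0\<close> reappears in the final subsequence.\<close>
  define v where "v n x = \<bar>u (n + n0) x\<bar> powr p" for n x
  have iv: "integrable M (v n)" for n
    unfolding v_def using n0[of "n + n0"] by (intro integrableI_nonneg) (auto intro: less_trans)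
  have "(\<lambda>n. \<integral>\<^sup>+x. ennreal (v n x) \<partial>M) \<longlonglongrightarrow> 0"
    unfolding v_def using LIMSEQ_ignore_initial_segment[OF lim, of n0] by simp
  moreover have "(\<integral>\<^sup>+x. ennreal (v n x) \<partial>M) = ennreal (\<integral>x. v n x \<partial>M)" for n
    using iv by (rule nn_integral_eq_integral) (simp add: v_def)
  ultimately have "(\<lambda>n. ennreal (\<integral>x. v n x \<partial>M)) \<longlonglongrightarrow> ennreal 0" by simp
  then have "(\<lambda>n. \<integral>x. v n x \<partial>M) \<longlonglongrightarrow> 0"
    by (subst (asm) tendsto_ennreal_iff) (auto simp: v_def[abs_def])
  moreover have "norm (v n x) = v n x" for n x by (simp add: v_def)
  ultimately have "(\<lambda>n. \<integral>x. norm (v n x) \<partial>M) \<longlonglongrightarrow> 0" by simp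
  from tendsto_L1_AE_subseq[OF iv this] obtain r
    where r: "strict_mono r" "AE x in M. (\<lambda>n. v (r n) x) \<longlonglongrightarrow> 0" by auto
  have "AE x in M. (\<lambda>n. u (r n + n0) x) \<longlonglongrightarrow> 0"
    using r(2)
  proof eventually_elim
    case (elim x)
    then have "(\<lambda>n. v (r n) x powr (1 / p)) \<longlonglongrightarrow> 0 powr (1 / p)"
      using p by (intro tendsto_powr') (auto simp: v_def)
    then have "(\<lambda>n. \<bar>u (r n + n0) x\<bar>) \<longlonglongrightarrow> 0"
      using p by (simp add: v_def powr_powr)
    then show ?case by (simp add: tendsto_rabs_zero_iff)
  qed
  moreover have "strict_mono (\<lambda>n. r n + n0)" using r(1) by (simp add: strict_mono_def)
  ultimately show ?thesis using that by blast
qed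

text \<open>Says that the quadratic form of \<open>U\<close> is controlled by the Dirichlet
  integral. The extended integral of the modulus makes integrability part of the bound; the Bochner
  integral would hide its failure behind the default value 0.\<close>

definition form_bounded :: "('a::euclidean_space \<Rightarrow> real) \<Rightarrow> real \<Rightarrow> bool" where
  "form_bounded U K \<longleftrightarrow> U \<in> borel_measurable lebesgue \<and> K \<ge> 0 \<and> (\<forall>\<phi>\<in>Cc_inf.
    (\<integral>\<^sup>+x. ennreal (\<bar>U x\<bar> * (\<phi> x)\<^sup>2) \<partial>lebesgue) \<le> ennreal (K * Dnorm2 (grad \<phi>)))"

lemma form_boundedD:
  assumes "form_bounded U K" "\<phi> \<in> Cc_inf"
  shows "integrable lebesgue (\<lambda>x. \<bar>U x\<bar> * (\<phi> x)\<^sup>2)"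
    and "integrable lebesgue (\<lambda>x. U x * (\<phi> x)\<^sup>2)"
    and "(\<integral>x. \<bar>U x\<bar> * (\<phi> x)\<^sup>2 \<partial>lebesgue) \<le> K * Dnorm2 (grad \<phi>)"
    and "\<bar>\<integral>x. U x * (\<phi> x)\<^sup>2 \<partial>lebesgue\<bar> \<le> K * Dnorm2 (grad \<phi>)"
proof -
  have U [measurable]: "U \<in> borel_measurable lebesgue" and K: "K \<ge> 0"
    and le: "(\<integral>\<^sup>+x. ennreal (\<bar>U x\<bar> * (\<phi> x)\<^sup>2) \<partial>lebesgue) \<le> ennreal (K * Dnorm2 (grad \<phi>))"
    using assms by (auto simp: form_bounded_def)
  have \<phi> [measurable]: "\<phi> \<in> borel_measurable lebesgue"
    using assms(2) by (intro smooth_measurable Cc_inf_smooth)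
  show 1: "integrable lebesgue (\<lambda>x. \<bar>U x\<bar> * (\<phi> x)\<^sup>2)"
  proof (rule integrableI_nonneg)
    show "(\<integral>\<^sup>+x. ennreal (\<bar>U x\<bar> * (\<phi> x)\<^sup>2) \<partial>lebesgue) < \<infinity>"
      using le by (rule le_less_trans) simp
  qed auto
  show "integrable lebesgue (\<lambda>x. U x * (\<phi> x)\<^sup>2)"
    by (rule Bochner_Integration.integrable_bound[OF 1]) (auto simp: abs_mult)
  show 2: "(\<integral>x. \<bar>U x\<bar> * (\<phi> x)\<^sup>2 \<partial>lebesgue) \<le> K * Dnorm2 (grad \<phi>)"
    using le K by (subst (asm) nn_integral_eq_integral[OF 1]) (auto simp: Dnorm2_nonneg)
  have "\<bar>\<integral>x. U x * (\<phi> x)\<^sup>2 \<partial>lebesgue\<bar> \<le> (\<integral>x. \<bar>U x * (\<phi> x)\<^sup>2\<bar> \<partial>lebesgue)"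
    by (rule integral_abs_bound)
  then show "\<bar>\<integral>x. U x * (\<phi> x)\<^sup>2 \<partial>lebesgue\<bar> \<le> K * Dnorm2 (grad \<phi>)"
    using 2 by (simp add: abs_mult)
qed

lemma nn_integral_grad_square:
  assumes "f \<in> Cc_inf"
  shows "(\<integral>\<^sup>+x. ennreal ((norm (grad f x))\<^sup>2) \<partial>lebesgue) = ennreal (Dnorm2 (grad f))"
  unfolding Dnorm2_def using integrable_grad_square[OF assms] by (rule nn_integral_eq_integral) simp

lemma norm_diff_square_le: "(norm (p - q))\<^sup>2 \<le> 2 * (norm (p - g))\<^sup>2 + 2 * (norm (q - g))\<^sup>2"
  for p q g :: "'a::real_normed_vector"
proof -
  have "(norm (p - q))\<^sup>2 \<le> (norm (p - g) + norm (q - g))\<^sup>2"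
    using norm_triangle_ineq4[of "p - g" "q - g"] by (intro power_mono) auto
  also have "\<dots> \<le> 2 * (norm (p - g))\<^sup>2 + 2 * (norm (q - g))\<^sup>2"
    using zero_le_power2[of "norm (p - g) - norm (q - g)"] by (simp add: power2_eq_square algebra_simps)
  finally show ?thesis .
qed

text \<open>A pointwise almost everywhere convergent subsequence and Fatou's lemma upgrade the
  convergence of the gradients to convergence in \<open>L\<^sup>2(\<bar>U\<bar> dx)\<close>.\<close>
lemma D12_approx:
  fixes U u :: "'a::euclidean_space \<Rightarrow> real"
  assumes N: "DIM('a) \<ge> 3" and U: "form_bounded U K" and ug: "(u, g) \<in> D12"
  obtains \<psi> :: "nat \<Rightarrow> 'a \<Rightarrow> real" where "\<And>n. \<psi> n \<in> Cc_inf"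
    "(\<lambda>n. Dnorm2 (grad (\<psi> n))) \<longlonglongrightarrow> Dnorm2 g"
    "(\<lambda>n. \<integral>x. U x * (\<psi> n x)\<^sup>2 \<partial>lebesgue) \<longlonglongrightarrow> (\<integral>x. U x * (u x)\<^sup>2 \<partial>lebesgue)"
proof -
  have Um [measurable]: "U \<in> borel_measurable lebesgue" and K: "K \<ge> 0"
    and hU: "\<forall>\<phi>\<in>Cc_inf. (\<integral>\<^sup>+x. ennreal (\<bar>U x\<bar> * (\<phi> x)\<^sup>2) \<partial>lebesgue) \<le> ennreal (K * Dnorm2 (grad \<phi>))"
    using U by (auto simp: form_bounded_def)
  from ug obtain \<phi> :: "nat \<Rightarrow> 'a \<Rightarrow> real"
    where u [measurable]: "u \<in> borel_measurable lebesgue" and g [measurable]: "g \<in> borel_measurable lebesgue"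
      and \<phi>: "\<And>n. \<phi> n \<in> Cc_inf"
      and lg: "(\<lambda>n. \<integral>\<^sup>+ x. ennreal ((norm (grad (\<phi> n) x - g x))\<^sup>2) \<partial>lebesgue) \<longlonglongrightarrow> 0"
      and lu: "(\<lambda>n. \<integral>\<^sup>+ x. ennreal (\<bar>\<phi> n x - u x\<bar> powr crit_exp TYPE('a)) \<partial>lebesgue) \<longlonglongrightarrow> 0"
    unfolding D12_def by blast
  have m: "\<phi> n \<in> borel_measurable lebesgue" for n
    by (intro smooth_measurable Cc_inf_smooth \<phi>)
  have p: "crit_exp TYPE('a) > 0" using N by (simp add: crit_exp_def)
  have "(\<lambda>x. \<phi> n x - u x) \<in> borel_measurable lebesgue" for n
    using m[of n] u by (rule borel_measurable_diff)
  then obtain r where r: "strict_mono r" "AE x in lebesgue. (\<lambda>n. \<phi> (r n) x - u x) \<longlonglongrightarrow> 0"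
    using nn_integral_powr_tendsto_AE_subseq[OF p _ lu] by blast
  define \<psi> where "\<psi> n = \<phi> (r n)" for n
  have \<psi>: "\<psi> n \<in> Cc_inf" for n using \<phi> by (simp add: \<psi>_def)
  have sm: "smooth (\<psi> n)" for n using \<psi> by (rule Cc_inf_smooth)
  have \<psi>m [measurable]: "\<psi> n \<in> borel_measurable lebesgue" "grad (\<psi> n) \<in> borel_measurable lebesgue" for n
    using sm by (auto intro: smooth_measurable)
  define e where "e n = (\<integral>\<^sup>+ x. ennreal ((norm (grad (\<psi> n) x - g x))\<^sup>2) \<partial>lebesgue)" for n
  have e0: "e \<longlonglongrightarrow> 0"
    using LIMSEQ_subseq_LIMSEQ[OF lg r(1)] by (simp add: e_def[abs_def] \<psi>_def o_def)
  \<comment> \<open>The form bound is applied to the difference of two approximants, whose gradients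
    are then compared through \<open>g\<close>.\<close>
  have bd: "(\<integral>\<^sup>+x. ennreal (\<bar>U x\<bar> * (\<psi> n x - \<psi> k x)\<^sup>2) \<partial>lebesgue) \<le> ennreal K * (2 * (e n + e k))" for n k
  proof -
    let ?d = "\<lambda>x. \<psi> n x - \<psi> k x"
    have d: "?d \<in> Cc_inf" by (rule Cc_inf_diff[OF \<psi> \<psi>])
    have "(\<integral>\<^sup>+x. ennreal (\<bar>U x\<bar> * (?d x)\<^sup>2) \<partial>lebesgue) \<le> ennreal K * ennreal (Dnorm2 (grad ?d))"
      unfolding ennreal_mult[OF K Dnorm2_nonneg, symmetric] using bspec[OF hU d] .
    also have "ennreal (Dnorm2 (grad ?d)) = (\<integral>\<^sup>+x. ennreal ((norm (grad (\<psi> n) x - grad (\<psi> k) x))\<^sup>2) \<partial>lebesgue)"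
      by (simp add: nn_integral_grad_square[OF d, symmetric] grad_diff[OF sm sm])
    also have "\<dots> \<le> (\<integral>\<^sup>+x. 2 * (ennreal ((norm (grad (\<psi> n) x - g x))\<^sup>2)
        + ennreal ((norm (grad (\<psi> k) x - g x))\<^sup>2)) \<partial>lebesgue)"
    proof (rule nn_integral_mono)
      fix x
      have "ennreal ((norm (grad (\<psi> n) x - grad (\<psi> k) x))\<^sup>2)
          \<le> ennreal (2 * ((norm (grad (\<psi> n) x - g x))\<^sup>2 + (norm (grad (\<psi> k) x - g x))\<^sup>2))"
        using norm_diff_square_le[of "grad (\<psi> n) x" "grad (\<psi> k) x" "g x"] by (intro ennreal_leI) simp
      also have "\<dots> = 2 * (ennreal ((norm (grad (\<psi> n) x - g x))\<^sup>2)
          + ennreal ((norm (grad (\<psi> k) x - g x))\<^sup>2))"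
        by (subst ennreal_mult) (auto simp: ennreal_plus)
      finally show "ennreal ((norm (grad (\<psi> n) x - grad (\<psi> k) x))\<^sup>2) \<le> \<dots>" .
    qed
    also have "\<dots> = 2 * (e n + e k)"
      unfolding e_def by (subst nn_integral_cmult, measurable, subst nn_integral_add) measurable
    finally show ?thesis by (simp add: mult_left_mono)
  qed
  have fatou: "(\<integral>\<^sup>+x. ennreal (\<bar>U x\<bar> * (\<psi> n x - u x)\<^sup>2) \<partial>lebesgue) \<le> ennreal K * (2 * e n)" for n
  proof -
    have "(\<integral>\<^sup>+x. ennreal (\<bar>U x\<bar> * (\<psi> n x - u x)\<^sup>2) \<partial>lebesgue)
        \<le> (\<integral>\<^sup>+x. liminf (\<lambda>k. ennreal (\<bar>U x\<bar> * (\<psi> n x - \<psi> k x)\<^sup>2)) \<partial>lebesgue)"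
    proof (rule nn_integral_mono_AE, use r(2) in eventually_elim)
      case (elim x)
      then have "(\<lambda>k. \<psi> k x) \<longlonglongrightarrow> u x" unfolding \<psi>_def by (rule LIM_zero_cancel)
      then have "(\<lambda>k. ennreal (\<bar>U x\<bar> * (\<psi> n x - \<psi> k x)\<^sup>2)) \<longlonglongrightarrow> ennreal (\<bar>U x\<bar> * (\<psi> n x - u x)\<^sup>2)"
        by (intro tendsto_intros tendsto_ennrealI)
      then show ?case by (intro eq_refl lim_imp_Liminf[symmetric] sequentially_bot)
    qed
    also have "\<dots> \<le> liminf (\<lambda>k. \<integral>\<^sup>+x. ennreal (\<bar>U x\<bar> * (\<psi> n x - \<psi> k x)\<^sup>2) \<partial>lebesgue)"
      by (intro nn_integral_liminf) measurable
    also have "\<dots> \<le> liminf (\<lambda>k. ennreal K * (2 * (e n + e k)))"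
      by (intro Liminf_mono always_eventually allI bd)
    also have "\<dots> = ennreal K * (2 * (e n + 0))"
      by (intro lim_imp_Liminf sequentially_bot ennreal_tendsto_cmult tendsto_add tendsto_const e0) auto
    finally show ?thesis by simp
  qed
  have "(\<lambda>n. ennreal K * (2 * e n)) \<longlonglongrightarrow> ennreal K * (2 * 0)"
    by (intro ennreal_tendsto_cmult e0) auto
  then have "(\<lambda>n. ennreal K * (2 * e n)) \<longlonglongrightarrow> 0" by simp
  then have lim: "(\<lambda>n. \<integral>\<^sup>+x. ennreal (\<bar>U x\<bar> * (\<psi> n x - u x)\<^sup>2) \<partial>lebesgue) \<longlonglongrightarrow> 0"
    by (rule tendsto_sandwich[OF _ _ tendsto_const, rotated 2]) (auto simp: fatou)
  \<comment> \<open>\<open>U\<close> is written as \<open>sgn U\<close> times the square of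
    \<open>sqrt \<bar>U\<bar>\<close>, so that \<open>lim\<close> becomes plain L2 convergence and
    the sign is a weight bounded by 1.\<close>
  have "(\<lambda>n. \<integral>x. sgn (U x) * (sqrt \<bar>U x\<bar> * \<psi> n x)\<^sup>2 \<partial>lebesgue)
      \<longlonglongrightarrow> (\<integral>x. sgn (U x) * (sqrt \<bar>U x\<bar> * u x)\<^sup>2 \<partial>lebesgue)"
  proof (rule square_integral_tendsto(2))
    show "\<bar>sgn (U x)\<bar> \<le> 1" for x by (simp add: sgn_if)
    show "integrable lebesgue (\<lambda>x. (sqrt \<bar>U x\<bar> * \<psi> n x)\<^sup>2)" for n
      using form_boundedD(1)[OF U \<psi>] by (simp add: power_mult_distrib)
    show "(\<lambda>n. \<integral>\<^sup>+x. ennreal ((sqrt \<bar>U x\<bar> * \<psi> n x - sqrt \<bar>U x\<bar> * u x)\<^sup>2) \<partial>lebesgue) \<longlonglongrightarrow> 0"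
      using lim by (simp add: right_diff_distrib[symmetric] power_mult_distrib)
  qed measurable
  then have "(\<lambda>n. \<integral>x. U x * (\<psi> n x)\<^sup>2 \<partial>lebesgue) \<longlonglongrightarrow> (\<integral>x. U x * (u x)\<^sup>2 \<partial>lebesgue)"
    by (simp add: power_mult_distrib mult.assoc[symmetric] sgn_mult_abs)
  moreover have "(\<lambda>n. Dnorm2 (grad (\<psi> n))) \<longlonglongrightarrow> Dnorm2 g"
  proof -
    \<comment> \<open>By the reverse triangle inequality the norms of the gradients converge in L2,
      so the scalar statement applies with weight 1.\<close>
    have "(\<lambda>n. \<integral>x. 1 * (norm (grad (\<psi> n) x))\<^sup>2 \<partial>lebesgue) \<longlonglongrightarrow> (\<integral>x. 1 * (norm (g x))\<^sup>2 \<partial>lebesgue)"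
    proof (rule square_integral_tendsto(2))
      show "integrable lebesgue (\<lambda>x. (norm (grad (\<psi> n) x))\<^sup>2)" for n
        by (rule integrable_grad_square[OF \<psi>])
      have "(\<integral>\<^sup>+x. ennreal ((norm (grad (\<psi> n) x) - norm (g x))\<^sup>2) \<partial>lebesgue) \<le> e n" for n
        unfolding e_def
      proof (intro nn_integral_mono ennreal_leI)
        fix x
        show "(norm (grad (\<psi> n) x) - norm (g x))\<^sup>2 \<le> (norm (grad (\<psi> n) x - g x))\<^sup>2"
          using norm_triangle_ineq3[of "grad (\<psi> n) x" "g x"] by (simp add: abs_le_square_iff[symmetric])
      qed
      then show "(\<lambda>n. \<integral>\<^sup>+x. ennreal ((norm (grad (\<psi> n) x) - norm (g x))\<^sup>2) \<partial>lebesgue) \<longlonglongrightarrow> 0"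
        by (intro tendsto_sandwich[OF _ _ tendsto_const e0]) auto
    qed auto
    then show ?thesis by (simp add: Dnorm2_def)
  qed
  ultimately show ?thesis using \<psi> that by blast
qed

section \<open>Reduction of \<open>mu\<close> to test functions\<close>

lemma Cc_inf_D12:
  assumes "\<phi> \<in> Cc_inf" shows "(\<phi>, grad \<phi>) \<in> D12"
  using assms unfolding D12_def
  by (auto intro!: exI[of _ "\<lambda>n. \<phi>"] smooth_measurable Cc_inf_smooth)

text \<open>A real \<open>Inf\<close> is known to lie below the members of its set only if the set
  is bounded below. The form bound provides this: every quotient is at least
  \<open>1 - K\<close>.\<close>

lemma mu_le_quotient:
  fixes U :: "'a::euclidean_space \<Rightarrow> real"
  assumes N: "DIM('a) \<ge> 3" and U: "form_bounded U K" and \<phi>: "\<phi> \<in> Cc_inf"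
  shows "mu U * Dnorm2 (grad \<phi>) \<le> Dnorm2 (grad \<phi>) - (\<integral>x. U x * (\<phi> x)\<^sup>2 \<partial>lebesgue)"
proof (cases "Dnorm2 (grad \<phi>) = 0")
  \<comment> \<open>Such a \<open>\<phi>\<close> contributes no quotient, but the form bound forces
    the integral to be 0 as well.\<close>
  case True
  then show ?thesis using form_boundedD(4)[OF U \<phi>] by simp
next
  case False
  then have pos: "Dnorm2 (grad \<phi>) > 0" using Dnorm2_nonneg[of "grad \<phi>"] by simp
  let ?S = "{(Dnorm2 g - (\<integral>x. U x * (u x)\<^sup>2 \<partial>lebesgue)) / Dnorm2 g | u g. (u, g) \<in> D12 \<and> Dnorm2 g \<noteq> 0}"
  have "bdd_below ?S"
  proof (rule bdd_belowI)
    fix y assume "y \<in> ?S"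
    then obtain u g where y: "y = (Dnorm2 g - (\<integral>x. U x * (u x)\<^sup>2 \<partial>lebesgue)) / Dnorm2 g"
      and ug: "(u, g) \<in> D12" "Dnorm2 g \<noteq> 0" by blast
    obtain \<psi> where \<psi>: "\<And>n. \<psi> n \<in> Cc_inf" "(\<lambda>n. Dnorm2 (grad (\<psi> n))) \<longlonglongrightarrow> Dnorm2 g"
      "(\<lambda>n. \<integral>x. U x * (\<psi> n x)\<^sup>2 \<partial>lebesgue) \<longlonglongrightarrow> (\<integral>x. U x * (u x)\<^sup>2 \<partial>lebesgue)"
      using D12_approx[OF N U ug(1)] by blast
    have "(\<integral>x. U x * (u x)\<^sup>2 \<partial>lebesgue) \<le> K * Dnorm2 g"
      by (rule LIMSEQ_le[OF \<psi>(3) tendsto_mult_left[OF \<psi>(2)]])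
        (use form_boundedD(4)[OF U \<psi>(1)] abs_le_D1 in blast)
    then show "1 - K \<le> y"
      using ug(2) Dnorm2_nonneg[of g] by (simp add: y le_divide_eq algebra_simps)
  qed
  then have "mu U \<le> (Dnorm2 (grad \<phi>) - (\<integral>x. U x * (\<phi> x)\<^sup>2 \<partial>lebesgue)) / Dnorm2 (grad \<phi>)"
    unfolding mu_def using Cc_inf_D12[OF \<phi>] False by (intro cInf_lower) auto
  then show ?thesis using pos by (simp add: le_divide_eq)
qed

text \<open>The inequality on test functions passes to the limit along the approximants of
  \<open>D12_approx\<close>. A pair with nonzero Dirichlet integral is supplied so that the infimum
  is over a nonempty set.\<close>

lemma mu_ge:
  fixes U :: "'a::euclidean_space \<Rightarrow> real"
  assumes N: "DIM('a) \<ge> 3" and U: "form_bounded U K"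
    and c: "\<And>\<phi>. \<phi> \<in> Cc_inf \<Longrightarrow> c * Dnorm2 (grad \<phi>) \<le> Dnorm2 (grad \<phi>) - (\<integral>x. U x * (\<phi> x)\<^sup>2 \<partial>lebesgue)"
    and ne: "(u0, g0) \<in> (D12 :: (('a \<Rightarrow> real) \<times> ('a \<Rightarrow> 'a)) set)" "Dnorm2 g0 \<noteq> 0"
  shows "c \<le> mu U"
  unfolding mu_def
proof (rule cInf_greatest)
  fix y assume "y \<in> {(Dnorm2 g - (\<integral>x. U x * (u x)\<^sup>2 \<partial>lebesgue)) / Dnorm2 g | u g. (u, g) \<in> D12 \<and> Dnorm2 g \<noteq> 0}"
  then obtain u g where y: "y = (Dnorm2 g - (\<integral>x. U x * (u x)\<^sup>2 \<partial>lebesgue)) / Dnorm2 g"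
    and ug: "(u, g) \<in> D12" "Dnorm2 g \<noteq> 0" by blast
  obtain \<psi> where \<psi>: "\<And>n. \<psi> n \<in> Cc_inf" "(\<lambda>n. Dnorm2 (grad (\<psi> n))) \<longlonglongrightarrow> Dnorm2 g"
    "(\<lambda>n. \<integral>x. U x * (\<psi> n x)\<^sup>2 \<partial>lebesgue) \<longlonglongrightarrow> (\<integral>x. U x * (u x)\<^sup>2 \<partial>lebesgue)"
    using D12_approx[OF N U ug(1)] by blast
  have "c * Dnorm2 g \<le> Dnorm2 g - (\<integral>x. U x * (u x)\<^sup>2 \<partial>lebesgue)"
    by (rule LIMSEQ_le[OF tendsto_mult_left[OF \<psi>(2)] tendsto_diff[OF \<psi>(2,3)]])
      (use c[OF \<psi>(1)] in blast)
  then show "c \<le> y"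
    using ug(2) Dnorm2_nonneg[of g] by (simp add: y le_divide_eq)
qed (use ne in blast)

section \<open>Operations preserving form bounds, and the inverse square weight\<close>

lemma form_bounded_mono:
  assumes V: "form_bounded V K" and U: "U \<in> borel_measurable lebesgue"
    and le: "AE x in lebesgue. \<bar>U x\<bar> \<le> \<bar>V x\<bar>"
  shows "form_bounded U K"
  unfolding form_bounded_def
proof (intro conjI ballI)
  fix \<phi> :: "'a \<Rightarrow> real" assume \<phi>: "\<phi> \<in> Cc_inf"
  have "(\<integral>\<^sup>+x. ennreal (\<bar>U x\<bar> * (\<phi> x)\<^sup>2) \<partial>lebesgue) \<le> (\<integral>\<^sup>+x. ennreal (\<bar>V x\<bar> * (\<phi> x)\<^sup>2) \<partial>lebesgue)"
    by (intro nn_integral_mono_AE, use le in eventually_elim) (intro ennreal_leI mult_right_mono, auto)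
  then show "(\<integral>\<^sup>+x. ennreal (\<bar>U x\<bar> * (\<phi> x)\<^sup>2) \<partial>lebesgue) \<le> ennreal (K * Dnorm2 (grad \<phi>))"
    using V \<phi> unfolding form_bounded_def by (meson order_trans)
qed (use U V in \<open>auto simp: form_bounded_def\<close>)

lemma form_bounded_add:
  assumes U: "form_bounded U K" and V: "form_bounded V L"
  shows "form_bounded (\<lambda>x. U x + V x) (K + L)"
  unfolding form_bounded_def
proof (intro conjI ballI)
  have [measurable]: "U \<in> borel_measurable lebesgue" "V \<in> borel_measurable lebesgue"
    using U V by (auto simp: form_bounded_def)
  show "(\<lambda>x. U x + V x) \<in> borel_measurable lebesgue" by measurable
  show "0 \<le> K + L" using U V by (auto simp: form_bounded_def)
  fix \<phi> :: "'a \<Rightarrow> real" assume \<phi>: "\<phi> \<in> Cc_inf"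
  have [measurable]: "\<phi> \<in> borel_measurable lebesgue" by (intro smooth_measurable Cc_inf_smooth \<phi>)
  have "(\<integral>\<^sup>+x. ennreal (\<bar>U x + V x\<bar> * (\<phi> x)\<^sup>2) \<partial>lebesgue)
      \<le> (\<integral>\<^sup>+x. ennreal (\<bar>U x\<bar> * (\<phi> x)\<^sup>2) + ennreal (\<bar>V x\<bar> * (\<phi> x)\<^sup>2) \<partial>lebesgue)"
  proof (rule nn_integral_mono)
    fix x
    show "ennreal (\<bar>U x + V x\<bar> * (\<phi> x)\<^sup>2) \<le> ennreal (\<bar>U x\<bar> * (\<phi> x)\<^sup>2) + ennreal (\<bar>V x\<bar> * (\<phi> x)\<^sup>2)"
      using mult_right_mono[OF abs_triangle_ineq[of "U x" "V x"], of "(\<phi> x)\<^sup>2"]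
      by (simp add: distrib_right flip: ennreal_plus)
  qed
  also have "\<dots> = (\<integral>\<^sup>+x. ennreal (\<bar>U x\<bar> * (\<phi> x)\<^sup>2) \<partial>lebesgue) + (\<integral>\<^sup>+x. ennreal (\<bar>V x\<bar> * (\<phi> x)\<^sup>2) \<partial>lebesgue)"
    by (rule nn_integral_add) measurable
  also have "\<dots> \<le> ennreal (K * Dnorm2 (grad \<phi>)) + ennreal (L * Dnorm2 (grad \<phi>))"
    using U V \<phi> by (intro add_mono) (auto simp: form_bounded_def)
  also have "\<dots> = ennreal ((K + L) * Dnorm2 (grad \<phi>))"
    using U V by (subst ennreal_plus[symmetric]) (auto simp: form_bounded_def Dnorm2_nonneg distrib_right)
  finally show "(\<integral>\<^sup>+x. ennreal (\<bar>U x + V x\<bar> * (\<phi> x)\<^sup>2) \<partial>lebesgue) \<le> ennreal ((K + L) * Dnorm2 (grad \<phi>))" .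
qed

lemma form_bounded_0: "form_bounded (\<lambda>x. 0) 0"
  by (simp add: form_bounded_def)

lemma form_bounded_sum:
  assumes "finite I" "\<And>i. i \<in> I \<Longrightarrow> \<exists>K. form_bounded (U i) K"
  shows "\<exists>K. form_bounded (\<lambda>x. \<Sum>i\<in>I. U i x) K"
  using assms
proof (induction I rule: finite_induct)
  case (insert i I)
  then obtain K L where "form_bounded (U i) K" "form_bounded (\<lambda>x. \<Sum>i\<in>I. U i x) L" by blast
  from form_bounded_add[OF this] show ?case using insert.hyps by auto
qed (auto intro: form_bounded_0)

lemma form_bounded_inverse_square:
  fixes a :: "'a::euclidean_space"
  assumes N: "DIM('a) \<ge> 3"
  shows "form_bounded (\<lambda>x. c / (norm (x - a))\<^sup>2) (\<bar>c\<bar> / ((real DIM('a) - 2) / 2)\<^sup>2)"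
  unfolding form_bounded_def
proof (intro conjI ballI)
  show "(\<lambda>x. c / (norm (x - a))\<^sup>2) \<in> borel_measurable lebesgue"
    by (intro measurable_completion) measurable
  fix \<phi> :: "'a \<Rightarrow> real" assume \<phi>: "\<phi> \<in> Cc_inf"
  have "(\<lambda>x. (\<phi> x)\<^sup>2 / (norm (x - a))\<^sup>2) \<in> borel_measurable lebesgue"
    using smooth_measurable(1)[OF Cc_inf_smooth[OF \<phi>]] by (intro measurable_completion) simp
  then have "(\<integral>\<^sup>+x. ennreal (\<bar>c / (norm (x - a))\<^sup>2\<bar> * (\<phi> x)\<^sup>2) \<partial>lebesgue)
      = ennreal \<bar>c\<bar> * (\<integral>\<^sup>+x. ennreal ((\<phi> x)\<^sup>2 / (norm (x - a))\<^sup>2) \<partial>lebesgue)"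
    by (subst nn_integral_cmult[symmetric]) (auto simp: ennreal_mult[symmetric])
  also have "\<dots> \<le> ennreal \<bar>c\<bar> * ennreal (Dnorm2 (grad \<phi>) / ((real DIM('a) - 2) / 2)\<^sup>2)"
    by (intro mult_left_mono hardy_inequality[OF N \<phi>]) simp
  also have "\<dots> = ennreal (\<bar>c\<bar> / ((real DIM('a) - 2) / 2)\<^sup>2 * Dnorm2 (grad \<phi>))"
    by (subst ennreal_mult[symmetric]) (auto simp: Dnorm2_nonneg)
  finally show "(\<integral>\<^sup>+x. ennreal (\<bar>c / (norm (x - a))\<^sup>2\<bar> * (\<phi> x)\<^sup>2) \<partial>lebesgue)
      \<le> ennreal (\<bar>c\<bar> / ((real DIM('a) - 2) / 2)\<^sup>2 * Dnorm2 (grad \<phi>))" .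
qed simp

section \<open>Localisation\<close>

lemma smooth_sin_cos:
  assumes "smooth f"
  shows "smooth (\<lambda>x. sin (f x))" "smooth (\<lambda>x. cos (f x))"
  using assms Ck_sin_cos unfolding smooth_def by blast+

lemma grad_sin_cos:
  assumes "smooth f"
  shows "grad (\<lambda>x. sin (f x)) x = cos (f x) *\<^sub>R grad f x"
    and "grad (\<lambda>x. cos (f x)) x = - sin (f x) *\<^sub>R grad f x"
  by (rule grad_eqI, auto intro!: derivative_eq_intros smooth_has_derivative[OF assms])+

text \<open>The mixed terms of the two squares have opposite signs and cancel;
  \<open>sin^2 + cos^2 = 1\<close> collects the rest.\<close>

lemma ims_localisation:
  assumes b: "smooth b" and \<phi>: "smooth \<phi>"
  shows "(norm (grad (\<lambda>x. sin (b x) * \<phi> x) x))\<^sup>2 + (norm (grad (\<lambda>x. cos (b x) * \<phi> x) x))\<^sup>2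
    = (norm (grad \<phi> x))\<^sup>2 + (\<phi> x)\<^sup>2 * (norm (grad b x))\<^sup>2"
proof -
  define s c p G B where "s = sin (b x)" and "c = cos (b x)" and "p = \<phi> x" and "G = grad \<phi> x" and "B = grad b x"
  have sc: "s * s + c * c = 1" using sin_cos_squared_add[of "b x"] by (simp add: s_def c_def power2_eq_square)
  have "(norm (s *\<^sub>R G + p *\<^sub>R (c *\<^sub>R B)))\<^sup>2 + (norm (c *\<^sub>R G + p *\<^sub>R (- s *\<^sub>R B)))\<^sup>2
      = (s * s + c * c) * (G \<bullet> G) + (s * s + c * c) * (p * p * (B \<bullet> B))"
    unfolding power2_norm_eq_inner
    by (simp add: inner_add_left inner_add_right inner_diff_left inner_diff_right inner_commute algebra_simps)
  also have "\<dots> = (norm G)\<^sup>2 + p\<^sup>2 * (norm B)\<^sup>2"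
    unfolding sc power2_norm_eq_inner by (simp add: power2_eq_square)
  finally show ?thesis
    unfolding grad_mult[OF smooth_sin_cos(1)[OF b] \<phi>] grad_mult[OF smooth_sin_cos(2)[OF b] \<phi>]
      grad_sin_cos[OF b]
    by (simp add: s_def c_def p_def G_def B_def)
qed

text \<open>The angle \<open>b = (\<pi>/2) (1 + \<bar>x\<bar>\<^sup>2)\<^sup>-\<^sup>\<kappa>\<close> decreases from \<open>\<pi>/2\<close> to \<open>0\<close> so slowly, for small \<open>\<kappa>\<close>,
  that its gradient is small compared with \<open>1/\<bar>x\<bar>\<close>.\<close>
lemma slow_angle:
  fixes \<eta> \<rho> :: real
  assumes \<eta>: "\<eta> > 0"
  obtains b :: "'a::euclidean_space \<Rightarrow> real" and R' where "smooth b" "R' > \<rho>"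
    "\<And>x. norm x < \<rho> \<Longrightarrow> (cos (b x))\<^sup>2 \<le> \<eta>" "\<And>x. norm x \<ge> R' \<Longrightarrow> (sin (b x))\<^sup>2 \<le> \<eta>"
    "\<And>x. (norm (grad b x))\<^sup>2 \<le> \<eta> / (norm x)\<^sup>2"
proof -
  \<comment> \<open>\<open>\<kappa>\<close> is chosen first: the gradient constant
    \<open>pi * \<kappa>\<close> and the deviation of the angle from \<open>pi / 2\<close> on the
    ball of radius \<open>\<rho>\<close> both tend to 0 with it. For that \<open>\<kappa>\<close>
    the angle still tends to 0 at infinity, which then yields \<open>t0\<close>.\<close>
  have "((\<lambda>\<kappa>. (pi * \<kappa>)\<^sup>2) \<longlongrightarrow> (pi * 0)\<^sup>2) (at_right 0)"
    by (intro tendsto_intros)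
  then have 1: "\<forall>\<^sub>F \<kappa> in at_right 0. (pi * \<kappa>)\<^sup>2 < \<eta>"
    using \<eta> by (intro order_tendstoD(2)) auto
  have "1 + \<rho>\<^sup>2 > 0" using zero_le_power2[of \<rho>] by linarith
  then have "((\<lambda>\<kappa>. (pi / 2 * (1 - (1 + \<rho>\<^sup>2) powr (- \<kappa>)))\<^sup>2) \<longlongrightarrow> (pi / 2 * (1 - (1 + \<rho>\<^sup>2) powr (- 0)))\<^sup>2) (at_right 0)"
    by (intro tendsto_intros) auto
  then have 2: "\<forall>\<^sub>F \<kappa> in at_right 0. (pi / 2 * (1 - (1 + \<rho>\<^sup>2) powr (- \<kappa>)))\<^sup>2 < \<eta>"
    using \<eta> \<open>1 + \<rho>\<^sup>2 > 0\<close> by (intro order_tendstoD(2)) auto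
  have "\<forall>\<^sub>F \<kappa> in at_right (0::real). \<kappa> > 0 \<and> (pi * \<kappa>)\<^sup>2 < \<eta> \<and> (pi / 2 * (1 - (1 + \<rho>\<^sup>2) powr (- \<kappa>)))\<^sup>2 < \<eta>"
    using 1 2 eventually_at_right_less by eventually_elim auto
  then obtain \<kappa> where \<kappa>: "\<kappa> > 0" "(pi * \<kappa>)\<^sup>2 < \<eta>" "(pi / 2 * (1 - (1 + \<rho>\<^sup>2) powr (- \<kappa>)))\<^sup>2 < \<eta>"
    using eventually_happens'[OF trivial_limit_at_right_real] by blast
  have "filterlim (\<lambda>t::real. 1 + t\<^sup>2) at_top at_top"
    by (intro filterlim_tendsto_add_at_top[OF tendsto_const] filterlim_pow_at_top filterlim_ident) simp
  then have "((\<lambda>t. (pi / 2 * (1 + t\<^sup>2) powr (- \<kappa>))\<^sup>2) \<longlongrightarrow> (pi / 2 * 0)\<^sup>2) at_top"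
    using \<kappa>(1) by (intro tendsto_intros tendsto_neg_powr) auto
  then have "\<forall>\<^sub>F t in at_top. (pi / 2 * (1 + t\<^sup>2) powr (- \<kappa>))\<^sup>2 < \<eta>"
    using \<eta> by (intro order_tendstoD(2)) auto
  then obtain t0 where t0: "\<And>t. t \<ge> t0 \<Longrightarrow> (pi / 2 * (1 + t\<^sup>2) powr (- \<kappa>))\<^sup>2 < \<eta>"
    by (auto simp: eventually_at_top_linorder)
  \<comment> \<open>Written in coordinates, \<open>1 + (norm x)^2\<close> is visibly built from
    functions covered by the \<open>Ck\<close> rules.\<close>
  define p where "p x = 1 + (\<Sum>i\<in>Basis. (x \<bullet> i) * (x \<bullet> i))" for x :: 'a
  have p: "p x = 1 + (norm x)\<^sup>2" for x
    unfolding p_def power2_norm_eq_inner euclidean_inner[of x x] by simp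
  have p1: "p x \<ge> 1" for x by (simp add: p)
  define b where "b x = pi / 2 * p x powr (- \<kappa>)" for x
  have "Ck k p" for k
    unfolding p_def by (intro Ck_add Ck_const Ck_sum finite_Basis Ck_mult Ck_inner)
  moreover have p0: "p x > 0" for x using p1[of x] by linarith
  ultimately have "Ck k b" for k unfolding b_def by (intro Ck_mult Ck_const Ck_powr)
  then have sb: "smooth b" by (simp add: smooth_def)
  have powr_le1: "p x powr (- \<kappa>) \<le> 1" for x
    using powr_mono2'[of "- \<kappa>" 1 "p x"] p1[of x] \<kappa>(1) by simp
  show ?thesis
  proof (rule that[OF sb])
    show "max t0 (\<bar>\<rho>\<bar> + 1) > \<rho>" by simp
    show "(cos (b x))\<^sup>2 \<le> \<eta>" if "norm x < \<rho>" for x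
    proof -
      have "\<bar>cos (b x)\<bar> = \<bar>sin (pi / 2 - b x)\<bar>" by (simp add: sin_diff)
      also have "\<dots> \<le> \<bar>pi / 2 - b x\<bar>" by (rule abs_sin_x_le_abs_x)
      also have "\<dots> = pi / 2 * (1 - p x powr (- \<kappa>))"
        using powr_le1[of x] by (simp add: b_def right_diff_distrib)
      also have "\<dots> \<le> pi / 2 * (1 - (1 + \<rho>\<^sup>2) powr (- \<kappa>))"
      proof -
        have "(norm x)\<^sup>2 \<le> \<rho>\<^sup>2" using that by (intro power_mono) auto
        then have "(1 + \<rho>\<^sup>2) powr (- \<kappa>) \<le> p x powr (- \<kappa>)"
          using \<kappa>(1) p0[of x] by (intro powr_mono2') (auto simp: p)
        then show ?thesis by (intro mult_left_mono) auto
      qed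
      finally have "\<bar>cos (b x)\<bar>\<^sup>2 \<le> (pi / 2 * (1 - (1 + \<rho>\<^sup>2) powr (- \<kappa>)))\<^sup>2"
        by (intro power_mono) auto
      then show ?thesis using \<kappa>(3) by simp
    qed
    show "(sin (b x))\<^sup>2 \<le> \<eta>" if "norm x \<ge> max t0 (\<bar>\<rho>\<bar> + 1)" for x
    proof -
      have "\<bar>sin (b x)\<bar> \<le> \<bar>b x\<bar>" by (rule abs_sin_x_le_abs_x)
      then have "\<bar>sin (b x)\<bar>\<^sup>2 \<le> \<bar>b x\<bar>\<^sup>2" by (intro power_mono) auto
      then show ?thesis using t0[of "norm x"] that by (simp add: b_def p)
    qed
    show "(norm (grad b x))\<^sup>2 \<le> \<eta> / (norm x)\<^sup>2" for x
    proof -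
      have "((\<lambda>x. 1 + x \<bullet> x) has_derivative (\<lambda>h. 2 * (x \<bullet> h))) (at x)"
        by (auto intro!: derivative_eq_intros simp: inner_commute)
      then have dp: "(p has_derivative (\<lambda>h. 2 * (x \<bullet> h))) (at x)"
        by (simp add: p[abs_def] power2_norm_eq_inner)
      have "((\<lambda>t. t powr (- \<kappa>)) has_real_derivative - \<kappa> * p x powr (- \<kappa> - 1)) (at (p x))"
        using p0 by (rule has_real_derivative_powr)
      from has_derivative_compose[OF dp this[unfolded has_field_derivative_def]]
      have "((\<lambda>x. pi / 2 * p x powr (- \<kappa>)) has_derivative
          (\<lambda>h. pi / 2 * (- \<kappa> * p x powr (- \<kappa> - 1) * (2 * (x \<bullet> h))))) (at x)"
        by (rule has_derivative_mult_right)
      then have "(b has_derivative (\<lambda>h. ((- (pi * \<kappa>) * p x powr (- \<kappa> - 1)) *\<^sub>R x) \<bullet> h)) (at x)"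
        by (simp add: b_def[abs_def] mult_ac)
      then have g: "grad b x = (- (pi * \<kappa>) * p x powr (- \<kappa> - 1)) *\<^sub>R x" by (rule grad_eqI)
      show ?thesis
      \<comment> \<open>At the origin the right side is 0 by division by zero, and the gradient
        vanishes there too. Elsewhere \<open>p x\<close> is at least
        \<open>(norm x)^2\<close>.\<close>
      proof (cases "x = 0")
        case False
        have "p x powr (- \<kappa> - 1) = p x powr (- \<kappa>) / p x"
          using p0[of x] by (simp add: powr_diff)
        also have "\<dots> \<le> 1 / p x" using powr_le1 p0[of x] by (intro divide_right_mono) auto
        finally have "pi * \<kappa> * p x powr (- \<kappa> - 1) * norm x \<le> pi * \<kappa> * (1 / p x) * norm x"
          using \<kappa>(1) by (intro mult_right_mono mult_left_mono) auto
        then have "norm (grad b x) \<le> pi * \<kappa> * (1 / p x) * norm x"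
          unfolding g using \<kappa>(1) by (simp add: abs_mult)
        also have "\<dots> \<le> pi * \<kappa> / norm x"
        proof -
          have "1 / p x * norm x \<le> 1 / norm x"
            using False p0[of x] by (simp add: p divide_simps power2_eq_square)
          then show ?thesis using mult_left_mono[of _ _ "pi * \<kappa>"] \<kappa>(1) by fastforce
        qed
        finally have "(norm (grad b x))\<^sup>2 \<le> (pi * \<kappa> / norm x)\<^sup>2" by (intro power_mono) auto
        also have "\<dots> \<le> \<eta> / (norm x)\<^sup>2"
          unfolding power_divide using \<kappa>(2) by (intro divide_right_mono) auto
        finally show ?thesis .
      qed (use g in auto)
    qed
  qed
qed

section \<open>Perturbing by an inverse square tail\<close>

lemma hardy_inequality_integral:
  fixes \<phi> :: "'a::euclidean_space \<Rightarrow> real"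
  assumes N: "DIM('a) \<ge> 3" and \<phi>: "\<phi> \<in> Cc_inf"
  shows "integrable lebesgue (\<lambda>x. (\<phi> x)\<^sup>2 / (norm x)\<^sup>2)"
    and "(\<integral>x. (\<phi> x)\<^sup>2 / (norm x)\<^sup>2 \<partial>lebesgue) \<le> Dnorm2 (grad \<phi>) / ((real DIM('a) - 2) / 2)\<^sup>2"
  using form_boundedD(2,3)[OF form_bounded_inverse_square[OF N, of 1 0] \<phi>] by simp_all

text \<open>Replacing \<open>\<gamma>\<close> by its positive part merges the two bounds in
  \<open>L\<close> into one: \<open>L + max \<gamma> 0\<close> stays below the Hardy constant for
  either sign of \<open>\<gamma>\<close>. Far out, only an upper bound on \<open>V\<close>
  enters.\<close>

lemma mu_add_far_inverse_square:
  fixes V :: "'a::euclidean_space \<Rightarrow> real"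
  assumes N: "DIM('a) \<ge> 3" and V: "form_bounded V K" and mu: "mu V > 0"
    and far: "\<And>x. norm x \<ge> \<rho> \<Longrightarrow> V x \<le> L / (norm x)\<^sup>2"
    and L: "L < ((real DIM('a) - 2) / 2)\<^sup>2" "L + \<gamma> < ((real DIM('a) - 2) / 2)\<^sup>2"
  shows "\<exists>R'>\<rho>. mu (\<lambda>x. V x + \<gamma> / (norm x)\<^sup>2 * indicator (- ball 0 R') x) > 0"
proof -
  define H where "H = ((real DIM('a) - 2) / 2)\<^sup>2"
  define g where "g = max \<gamma> 0"
  \<comment> \<open>Truncated at 0 so that Hardy's inequality may be multiplied by
    \<open>\<Lambda>\<close>.\<close>
  define \<Lambda> where "\<Lambda> = max 0 (L + g)"
  define m where "m = mu V"
  \<comment> \<open>\<open>c\<close> is the margin that both localised pieces have in common.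
    \<open>A\<close> collects the error constants: \<open>1 / H\<close> from the gradient of the
    angle, \<open>K\<close> from \<open>V\<close>, and \<open>g / H\<close> from the new term. With
    this \<open>\<eta>\<close> the errors use up exactly half of the margin.\<close>
  define c where "c = min m (1 - \<Lambda> / H)"
  define A where "A = 1 / H + K + g / H"
  define \<eta> where "\<eta> = c / (2 * A)"
  have H: "H > 0" using N by (simp add: H_def)
  have K: "K \<ge> 0" using V by (simp add: form_bounded_def)
  have g: "g \<ge> 0" "\<gamma> \<le> g" by (auto simp: g_def)
  have \<Lambda>: "\<Lambda> \<ge> 0" "\<Lambda> < H" "L + g \<le> \<Lambda>" using L H by (auto simp: \<Lambda>_def g_def H_def)
  have c: "c > 0" using mu \<Lambda> H by (simp add: c_def m_def)
  have A: "A > 0" using H K g by (simp add: A_def add_pos_nonneg)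
  have \<eta>: "\<eta> > 0" "\<eta> * A = c / 2" using c A by (auto simp: \<eta>_def)
  obtain b :: "'a \<Rightarrow> real" and R' where b: "smooth b" and R': "R' > \<rho>"
    and cosb: "\<And>x. norm x < \<rho> \<Longrightarrow> (cos (b x))\<^sup>2 \<le> \<eta>"
    and sinb: "\<And>x. norm x \<ge> R' \<Longrightarrow> (sin (b x))\<^sup>2 \<le> \<eta>"
    and gb: "\<And>x. (norm (grad b x))\<^sup>2 \<le> \<eta> / (norm x)\<^sup>2"
    using slow_angle[OF \<eta>(1)] by metis
  define U where "U x = V x + \<gamma> / (norm x)\<^sup>2 * indicator (- ball 0 R') x" for x
  have U: "\<exists>K'. form_bounded U K'"
  proof -
    have inv: "form_bounded (\<lambda>x::'a. \<gamma> / (norm x)\<^sup>2) (\<bar>\<gamma>\<bar> / H)"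
      using form_bounded_inverse_square[OF N, of \<gamma> 0] by (simp add: H_def)
    have "form_bounded (\<lambda>x::'a. \<gamma> / (norm x)\<^sup>2 * indicator (- ball 0 R') x) (\<bar>\<gamma>\<bar> / H)"
    proof (rule form_bounded_mono[OF inv])
      show "(\<lambda>x. \<gamma> / (norm x)\<^sup>2 * indicator (- ball 0 R') x) \<in> borel_measurable (lebesgue :: 'a measure)"
        by (intro measurable_completion) measurable
    qed (auto split: split_indicator)
    from form_bounded_add[OF V this] show ?thesis unfolding U_def by blast
  qed
  have main: "c / 2 * Dnorm2 (grad \<phi>) \<le> Dnorm2 (grad \<phi>) - (\<integral>x. U x * (\<phi> x)\<^sup>2 \<partial>lebesgue)"
    if \<phi>: "\<phi> \<in> Cc_inf" for \<phi> :: "'a \<Rightarrow> real"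
  proof -
    let ?s = "\<lambda>x. sin (b x) * \<phi> x" and ?c = "\<lambda>x. cos (b x) * \<phi> x"
    have s: "?s \<in> Cc_inf" and cc: "?c \<in> Cc_inf"
      using Cc_inf_mult_left \<phi> smooth_sin_cos[OF b] by blast+
    define D D1 D2 where "D = Dnorm2 (grad \<phi>)" and "D1 = Dnorm2 (grad ?s)" and "D2 = Dnorm2 (grad ?c)"
    have D: "D \<ge> 0" "D1 \<ge> 0" "D2 \<ge> 0" by (auto simp: D_def D1_def D2_def Dnorm2_nonneg)
    note hardy = hardy_inequality_integral[OF N, folded H_def]
    have sq: "integrable lebesgue (\<lambda>x. (norm (grad \<phi> x))\<^sup>2)"
      "integrable lebesgue (\<lambda>x. (norm (grad ?s x))\<^sup>2 + (norm (grad ?c x))\<^sup>2)"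
      using integrable_grad_square[OF \<phi>] integrable_grad_square[OF s] integrable_grad_square[OF cc] by auto
    have D12: "D1 + D2 = (\<integral>x. (norm (grad ?s x))\<^sup>2 + (norm (grad ?c x))\<^sup>2 \<partial>lebesgue)"
      unfolding D1_def D2_def Dnorm2_def
      using integrable_grad_square[OF s] integrable_grad_square[OF cc] by simp
    note ims = ims_localisation[OF b Cc_inf_smooth[OF \<phi>]]
    \<comment> \<open>Dropping the nonnegative localisation error gives \<open>low\<close>, which
      carries the margin from \<open>D1 + D2\<close> back to \<open>D\<close>; estimating that error
      by Hardy's inequality gives \<open>up\<close>.\<close>
    have low: "D \<le> D1 + D2"
      unfolding D12 unfolding D_def Dnorm2_def by (rule integral_mono[OF sq]) (simp add: ims)
    have "D1 + D2 \<le> (\<integral>x. (norm (grad \<phi> x))\<^sup>2 + \<eta> * ((\<phi> x)\<^sup>2 / (norm x)\<^sup>2) \<partial>lebesgue)"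
      unfolding D12
    proof (rule integral_mono[OF sq(2)])
      show "integrable lebesgue (\<lambda>x. (norm (grad \<phi> x))\<^sup>2 + \<eta> * ((\<phi> x)\<^sup>2 / (norm x)\<^sup>2))"
        by (intro Bochner_Integration.integrable_add integrable_mult_right sq(1) hardy(1)[OF \<phi>])
      show "(norm (grad ?s x))\<^sup>2 + (norm (grad ?c x))\<^sup>2 \<le> (norm (grad \<phi> x))\<^sup>2 + \<eta> * ((\<phi> x)\<^sup>2 / (norm x)\<^sup>2)" for x
        unfolding ims using mult_left_mono[OF gb[of x], of "(\<phi> x)\<^sup>2"] by (simp add: mult.commute)
    qed
    also have "\<dots> = D + \<eta> * (\<integral>x. (\<phi> x)\<^sup>2 / (norm x)\<^sup>2 \<partial>lebesgue)"
      unfolding D_def Dnorm2_def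
      by (subst Bochner_Integration.integral_add integral_mult_right_zero
          | intro integrable_mult_right sq(1) hardy(1)[OF \<phi>] refl)+
    also have "\<dots> \<le> D + \<eta> * (D / H)"
      using mult_left_mono[OF hardy(2)[OF \<phi>], of \<eta>] \<eta>(1) by (simp add: D_def)
    finally have up: "D1 + D2 \<le> D + \<eta> * (D / H)" .
    \<comment> \<open>For \<open>norm x < \<rho>\<close> the new term is absent, and the
      \<open>cos^2\<close> share of \<open>V\<close> is an error since \<open>cos^2\<close> is at
      most \<open>\<eta>\<close>. Otherwise \<open>far\<close> bounds the \<open>cos^2\<close> share
      of \<open>V\<close> and of the new term jointly by \<open>\<Lambda>\<close>, and the
      \<open>sin^2\<close> share of the new term is an error, as that term lives where
      \<open>sin^2\<close> is at most \<open>\<eta>\<close>.\<close>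
    have pw: "U x * (\<phi> x)\<^sup>2 \<le> V x * (?s x)\<^sup>2 + \<Lambda> * ((?c x)\<^sup>2 / (norm x)\<^sup>2) + \<eta> * (\<bar>V x\<bar> * (\<phi> x)\<^sup>2)
        + \<eta> * g * ((\<phi> x)\<^sup>2 / (norm x)\<^sup>2)" for x
    proof -
      define S C n I where "S = (sin (b x))\<^sup>2" and "C = (cos (b x))\<^sup>2" and "n = 1 / (norm x)\<^sup>2"
        and "I = (indicator (- ball 0 R') x :: real)"
      have SC: "S + C = 1" "S \<ge> 0" "C \<ge> 0" by (auto simp: S_def C_def)
      have n: "n \<ge> 0" by (simp add: n_def)
      have I: "I = 1 \<and> norm x \<ge> R' \<or> I = 0 \<and> norm x < R'" by (auto simp: I_def indicator_def)
      have "V x + \<gamma> * n * I \<le> V x * S + \<Lambda> * n * C + \<eta> * \<bar>V x\<bar> + \<eta> * g * n"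
      proof (cases "norm x < \<rho>")
        case True
        have "V x * C \<le> \<bar>V x\<bar> * C" using SC by (intro mult_right_mono) auto
        also have "\<dots> \<le> \<bar>V x\<bar> * \<eta>" using cosb[OF True] by (intro mult_left_mono) (auto simp: C_def)
        finally have "V x * C \<le> \<eta> * \<bar>V x\<bar>" by (simp add: mult.commute)
        moreover have "V x = V x * S + V x * C" using SC by (simp flip: distrib_left)
        moreover have "0 \<le> \<Lambda> * n * C" "0 \<le> \<eta> * g * n" using \<Lambda> n SC \<eta> g by simp_all
        moreover have "I = 0" using True R' I by auto
        ultimately show ?thesis by simp
      next
        case False
        have "\<gamma> * n * I \<le> g * n * I" using g n I by (intro mult_right_mono) auto
        also have "\<dots> = g * n * I * S + g * n * I * C" using SC by (simp flip: distrib_left)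
        also have "\<dots> \<le> \<eta> * g * n + g * n * C"
        proof (rule add_mono)
          show "g * n * I * S \<le> \<eta> * g * n"
          proof (cases "I = 0")
            case False
            then have "S \<le> \<eta>" "I = 1" using I sinb[of x] by (auto simp: S_def)
            then have "g * n * S \<le> g * n * \<eta>" using g n by (intro mult_left_mono) auto
            then show ?thesis using \<open>I = 1\<close> by (simp add: mult_ac)
          qed (use \<eta> g n in simp)
          show "g * n * I * C \<le> g * n * C"
            using I g n SC by auto
        qed
        finally have 1: "\<gamma> * n * I \<le> \<eta> * g * n + g * n * C" .
        have "V x * C \<le> L * n * C"
          using far[of x] False SC by (intro mult_right_mono) (auto simp: n_def)
        moreover have "(L + g) * (n * C) \<le> \<Lambda> * (n * C)" using \<Lambda> n SC by (intro mult_right_mono) auto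
        moreover have "V x = V x * S + V x * C" using SC by (simp flip: distrib_left)
        moreover have "0 \<le> \<eta> * \<bar>V x\<bar>" using \<eta> by simp
        ultimately show ?thesis using 1 by (simp add: algebra_simps)
      qed
      from mult_right_mono[OF this, of "(\<phi> x)\<^sup>2"] show ?thesis
        by (simp add: U_def S_def C_def n_def I_def power_mult_distrib algebra_simps)
    qed
    note iV = form_boundedD[OF V]
    obtain K' where K': "form_bounded U K'" using U by blast
    have "(\<integral>x. U x * (\<phi> x)\<^sup>2 \<partial>lebesgue) \<le> (\<integral>x. V x * (?s x)\<^sup>2 + \<Lambda> * ((?c x)\<^sup>2 / (norm x)\<^sup>2)
        + \<eta> * (\<bar>V x\<bar> * (\<phi> x)\<^sup>2) + \<eta> * g * ((\<phi> x)\<^sup>2 / (norm x)\<^sup>2) \<partial>lebesgue)"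
      by (rule integral_mono[OF form_boundedD(2)[OF K' \<phi>] _ pw])
        (intro Bochner_Integration.integrable_add integrable_mult_right iV(1)[OF \<phi>] iV(2)[OF s] hardy(1) \<phi> cc)
    also have "\<dots> = (\<integral>x. V x * (?s x)\<^sup>2 \<partial>lebesgue) + \<Lambda> * (\<integral>x. (?c x)\<^sup>2 / (norm x)\<^sup>2 \<partial>lebesgue)
        + \<eta> * (\<integral>x. \<bar>V x\<bar> * (\<phi> x)\<^sup>2 \<partial>lebesgue) + \<eta> * g * (\<integral>x. (\<phi> x)\<^sup>2 / (norm x)\<^sup>2 \<partial>lebesgue)"
      by (subst Bochner_Integration.integral_add integral_mult_right_zero
          | intro Bochner_Integration.integrable_add integrable_mult_right iV(1)[OF \<phi>] iV(2)[OF s] hardy(1) \<phi> cc refl)+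
    also have "\<dots> \<le> (D1 - m * D1) + \<Lambda> * (D2 / H) + \<eta> * (K * D) + \<eta> * g * (D / H)"
    proof (intro add_mono mult_left_mono)
      show "(\<integral>x. V x * (?s x)\<^sup>2 \<partial>lebesgue) \<le> D1 - m * D1"
        using mu_le_quotient[OF N V s] by (simp add: D1_def m_def)
    qed (use hardy(2)[OF cc] hardy(2)[OF \<phi>] iV(3)[OF \<phi>] \<Lambda> \<eta> g in \<open>auto simp: D_def D2_def\<close>)
    finally have "(\<integral>x. U x * (\<phi> x)\<^sup>2 \<partial>lebesgue)
        \<le> (D1 - m * D1) + \<Lambda> * (D2 / H) + \<eta> * (K * D) + \<eta> * g * (D / H)" .
    \<comment> \<open>Each piece keeps at least the margin \<open>c\<close>: the first through
      \<open>mu V\<close>, the second through the gap between \<open>\<Lambda>\<close> and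
      \<open>H\<close>.\<close>
    moreover have "c * D1 \<le> m * D1" "c * D2 \<le> (1 - \<Lambda> / H) * D2"
      using D by (auto intro!: mult_right_mono simp: c_def)
    moreover have "c * D \<le> c * (D1 + D2)" using low c by simp
    moreover have "\<eta> * (D / H) + \<eta> * (K * D) + \<eta> * g * (D / H) = c / 2 * D"
      unfolding \<eta>(2)[symmetric] A_def by (simp add: algebra_simps)
    ultimately show ?thesis using up by (simp add: D_def[symmetric] algebra_simps)
  qed
  have "mu U > 0"
  proof (cases "\<exists>u0 g0. (u0, g0) \<in> (D12 :: (('a \<Rightarrow> real) \<times> ('a \<Rightarrow> 'a)) set) \<and> Dnorm2 g0 \<noteq> 0")
    case True
    then obtain u0 g0 where "(u0, g0) \<in> (D12 :: (('a \<Rightarrow> real) \<times> ('a \<Rightarrow> 'a)) set)" "Dnorm2 g0 \<noteq> 0" by blast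
    moreover obtain K' where "form_bounded U K'" using U by blast
    ultimately have "c / 2 \<le> mu U" using mu_ge[OF N _ main] by blast
    then show ?thesis using c by simp
  next
    case False
    \<comment> \<open>Both infima are taken over the empty set, whose \<open>Inf\<close> is an unspecified real.\<close>
    then have "mu U = mu V" unfolding mu_def by (intro arg_cong[of _ _ Inf]) blast
    then show ?thesis using mu by simp
  qed
  then show ?thesis using R' unfolding U_def by blast
qed

section \<open>The class of potentials\<close>

text \<open>Almost everywhere \<open>W\<close> is dominated by \<open>B / (norm x)^2\<close>:
  outside the ball of radius \<open>M\<close> by decay, inside it because a bounded function there
  is at most a multiple of \<open>M^2 / (norm x)^2\<close>.\<close>

lemma form_bounded_decaying:
  fixes W :: "'a::euclidean_space \<Rightarrow> real"
  assumes N: "DIM('a) \<ge> 3" and W: "in_Linf W" and \<delta>: "\<delta> > 0"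
    and decay: "\<forall>x. norm x \<ge> \<rho> \<longrightarrow> \<bar>W x\<bar> \<le> C * norm x powr (-2 - \<delta>)"
  shows "\<exists>K. form_bounded W K"
proof -
  obtain C0 where C0: "AE x in lebesgue. \<bar>W x\<bar> \<le> C0" and Wm: "W \<in> borel_measurable lebesgue"
    using W by (auto simp: in_Linf_def)
  \<comment> \<open>\<open>M\<close> is at least 1 so that
    \<open>norm x powr (-2 - \<delta>)\<close> is at most \<open>norm x powr (-2)\<close> beyond
    it.\<close>
  define M where "M = max \<rho> 1"
  define B where "B = \<bar>C\<bar> + \<bar>C0\<bar> * M\<^sup>2"
  have B: "B \<ge> 0" by (simp add: B_def)
  have "form_bounded (\<lambda>x::'a. B / (norm x)\<^sup>2) (\<bar>B\<bar> / ((real DIM('a) - 2) / 2)\<^sup>2)"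
    using form_bounded_inverse_square[OF N, of B 0] by simp
  \<comment> \<open>At the origin \<open>B / (norm x)^2\<close> is 0 by convention and need not
    dominate \<open>W\<close>, so this null set is removed.\<close>
  moreover have "AE x in lebesgue. x \<noteq> (0::'a)"
    by (intro AE_completion AE_lborel_singleton)
  then have "AE x in lebesgue. \<bar>W x\<bar> \<le> \<bar>B / (norm x)\<^sup>2\<bar>"
    using C0
  proof eventually_elim
    case (elim x)
    have "\<bar>W x\<bar> * (norm x)\<^sup>2 \<le> B"
    proof (cases "norm x \<ge> M")
      case True
      then have x: "norm x \<ge> 1" "norm x \<ge> \<rho>" by (auto simp: M_def)
      have "\<bar>W x\<bar> \<le> C * norm x powr (-2 - \<delta>)" using decay x(2) by blast
      also have "\<dots> \<le> \<bar>C\<bar> * norm x powr (-2)"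
        using x(1) \<delta> by (intro mult_mono powr_mono) auto
      finally have "\<bar>W x\<bar> * (norm x)\<^sup>2 \<le> \<bar>C\<bar> * norm x powr (-2) * (norm x)\<^sup>2" by (intro mult_right_mono) auto
      also have "\<dots> = \<bar>C\<bar>" using elim(1) by (simp add: powr_minus powr_numeral)
      finally show ?thesis by (auto simp: B_def intro: order_trans)
    next
      case False
      then have "(norm x)\<^sup>2 \<le> M\<^sup>2" by (intro power_mono) auto
      then have "\<bar>W x\<bar> * (norm x)\<^sup>2 \<le> \<bar>C0\<bar> * M\<^sup>2" using elim(2) by (intro mult_mono) auto
      then show ?thesis by (simp add: B_def)
    qed
    then show ?case using elim(1) B by (simp add: le_divide_eq)
  qed
  ultimately show ?thesis using form_bounded_mono[OF _ Wm] by blast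
qed

lemma form_bounded_cutoff_inverse_square:
  fixes a :: "'a::euclidean_space"
  assumes N: "DIM('a) \<ge> 3" and A [measurable]: "A \<in> sets borel"
  shows "\<exists>K. form_bounded (\<lambda>x. l * indicator A x / (norm (x - a))\<^sup>2) K"
proof (rule exI, rule form_bounded_mono[OF form_bounded_inverse_square[OF N]])
  show "(\<lambda>x. l * indicator A x / (norm (x - a))\<^sup>2) \<in> borel_measurable lebesgue"
    by (intro measurable_completion) measurable
  show "AE x in lebesgue. \<bar>l * indicator A x / (norm (x - a))\<^sup>2\<bar> \<le> \<bar>l / (norm (x - a))\<^sup>2\<bar>"
    by (auto split: split_indicator)
qed

lemma form_bounded_Vpot:
  fixes W :: "'a::euclidean_space \<Rightarrow> real"
  assumes N: "DIM('a) \<ge> 3" and W: "\<exists>K. form_bounded W K"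
  shows "\<exists>K. form_bounded (Vpot k a r lam lam_inf R W) K"
proof -
  obtain K1 where K1: "form_bounded (\<lambda>x. \<Sum>i<k. lam i * indicator (ball (a i) (r i)) x / (norm (x - a i))\<^sup>2) K1"
    using form_bounded_sum[OF finite_lessThan form_bounded_cutoff_inverse_square[OF N]] by fastforce
  obtain K2 where K2: "form_bounded (\<lambda>x::'a. lam_inf * indicator (- ball 0 R) x / (norm (x - 0))\<^sup>2) K2"
    using form_bounded_cutoff_inverse_square[OF N, of "- ball 0 R" lam_inf 0] by auto
  obtain K3 where K3: "form_bounded W K3" using W by blast
  show ?thesis
    using form_bounded_add[OF form_bounded_add[OF K1 K2] K3] by (auto simp: Vpot_def[abs_def])
qed

text \<open>Beyond a large radius all balls around the poles are left behind, the indicator at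
  infinity equals 1, and the extra decay \<open>\<delta>\<close> pushes \<open>W\<close> below
  \<open>\<epsilon> / (norm x)^2\<close>.\<close>

lemma Vpot_far:
  fixes W :: "'a::euclidean_space \<Rightarrow> real"
  assumes \<delta>: "\<delta> > 0" and \<epsilon>: "\<epsilon> > 0"
    and decay: "\<forall>x. norm x \<ge> \<rho> \<longrightarrow> \<bar>W x\<bar> \<le> C * norm x powr (-2 - \<delta>)"
  shows "\<exists>t\<ge>R. \<forall>x. norm x \<ge> t \<longrightarrow> Vpot k a r lam lam_inf R W x \<le> (lam_inf + \<epsilon>) / (norm x)\<^sup>2"
proof -
  have "((\<lambda>t. C * t powr (- \<delta>)) \<longlongrightarrow> C * 0) at_top"
    using \<delta> by (intro tendsto_intros tendsto_neg_powr filterlim_ident) auto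
  then have "\<forall>\<^sub>F t in at_top. C * t powr (- \<delta>) < \<epsilon>"
    using \<epsilon> by (intro order_tendstoD(2)) auto
  moreover have "\<forall>\<^sub>F t in at_top. \<forall>i\<in>{..<k}. norm (a i) + r i \<le> t"
    by (intro eventually_ball_finite ballI eventually_ge_at_top) auto
  ultimately have "\<forall>\<^sub>F t in at_top. C * t powr (- \<delta>) < \<epsilon> \<and> (\<forall>i\<in>{..<k}. norm (a i) + r i \<le> t)
      \<and> t \<ge> R \<and> t \<ge> \<rho> \<and> t \<ge> 1"
    using eventually_ge_at_top[of R] eventually_ge_at_top[of \<rho>] eventually_ge_at_top[of 1]
    by eventually_elim auto
  then obtain t where t: "\<And>s. s \<ge> t \<Longrightarrow> C * s powr (- \<delta>) < \<epsilon> \<and> (\<forall>i\<in>{..<k}. norm (a i) + r i \<le> s)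
      \<and> s \<ge> R \<and> s \<ge> \<rho> \<and> s \<ge> 1"
    by (auto simp: eventually_at_top_linorder)
  have "Vpot k a r lam lam_inf R W x \<le> (lam_inf + \<epsilon>) / (norm x)\<^sup>2" if x: "norm x \<ge> t" for x
  proof -
    note tx = t[OF x]
    have "indicator (ball (a i) (r i)) x = (0::real)" if "i < k" for i
    proof -
      have "norm (a i) + r i \<le> norm x" using tx that by auto
      then have "r i \<le> dist (a i) x"
        using norm_triangle_ineq2[of x "a i"] by (simp add: dist_norm norm_minus_commute)
      then show ?thesis by (simp add: indicator_def)
    qed
    then have "Vpot k a r lam lam_inf R W x = lam_inf / (norm x)\<^sup>2 + W x"
      using tx by (simp add: Vpot_def)
    moreover have "W x \<le> \<epsilon> / (norm x)\<^sup>2"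
    proof -
      have "W x \<le> C * norm x powr (-2 - \<delta>)" using decay tx abs_le_D1 by blast
      also have "\<dots> = C * norm x powr (- \<delta>) / (norm x)\<^sup>2"
      proof -
        have "norm x powr (-2 - \<delta>) = norm x powr (- \<delta>) / norm x powr 2"
          unfolding powr_diff[symmetric] by (rule arg_cong[of _ _ "\<lambda>c. norm x powr c"]) simp
        then show ?thesis using tx by (simp add: powr_numeral)
      qed
      also have "\<dots> \<le> \<epsilon> / (norm x)\<^sup>2" using tx by (intro divide_right_mono) auto
      finally show ?thesis .
    qed
    ultimately show ?thesis by (simp add: add_divide_distrib)
  qed
  then show ?thesis using t[OF order_refl] by blast
qed

theorem theorem4p2:
  fixes k :: nat and a :: "nat \<Rightarrow> 'a::euclidean_space" and r lam :: "nat \<Rightarrow> real"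
    and lam_inf R gam_inf :: real and W :: "'a \<Rightarrow> real"
  assumes N3: "DIM('a) \<ge> 3"
    and r_pos: "\<forall>i<k. r i > 0" and R_pos: "R > 0"
    and a_dist: "\<forall>i<k. \<forall>j<k. i \<noteq> j \<longrightarrow> a i \<noteq> a j"
    and lam_lt: "\<forall>i<k. lam i < (real DIM('a) - 2)\<^sup>2 / 4"
    and lam_inf_lt: "lam_inf < (real DIM('a) - 2)\<^sup>2 / 4"
    and W_LN2: "in_Lp (real DIM('a) / 2) W" and W_Linf: "in_Linf W"
    and W_decay: "\<exists>\<delta>>0. \<exists>C \<rho>. \<forall>x. norm x \<ge> \<rho> \<longrightarrow> \<bar>W x\<bar> \<le> C * norm x powr (-2 - \<delta>)"
    and mu_pos: "mu (Vpot k a r lam lam_inf R W) > 0"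
    and gam: "lam_inf + gam_inf < ((real DIM('a) - 2) / 2)\<^sup>2"
  shows "\<exists>R'>R. mu (\<lambda>x. Vpot k a r lam lam_inf R W x
                       + gam_inf / (norm x)\<^sup>2 * indicator (- ball 0 R') x) > 0"
proof -
  obtain \<delta> C \<rho> where \<delta>: "\<delta> > 0" and decay: "\<forall>x. norm x \<ge> \<rho> \<longrightarrow> \<bar>W x\<bar> \<le> C * norm x powr (-2 - \<delta>)"
    using W_decay by blast
  obtain K where K: "form_bounded (Vpot k a r lam lam_inf R W) K"
    using form_bounded_Vpot[OF N3 form_bounded_decaying[OF N3 W_Linf \<delta> decay]] by blast
  define H where "H = ((real DIM('a) - 2) / 2)\<^sup>2"
  \<comment> \<open>Half of the smaller of the gaps \<open>H - lam_inf\<close> and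
    \<open>H - lam_inf - gam_inf\<close>, so that both stay positive after \<open>lam_inf\<close> is
    raised by \<open>\<epsilon>\<close>.\<close>
  define \<epsilon> where "\<epsilon> = (H - lam_inf - max gam_inf 0) / 2"
  have "lam_inf < H" using lam_inf_lt by (simp add: H_def power_divide)
  then have \<epsilon>: "\<epsilon> > 0" using gam by (simp add: \<epsilon>_def H_def)
  obtain t where t: "t \<ge> R"
    "\<And>x. norm x \<ge> t \<Longrightarrow> Vpot k a r lam lam_inf R W x \<le> (lam_inf + \<epsilon>) / (norm x)\<^sup>2"
    using Vpot_far[OF \<delta> \<epsilon> decay] by blast
  have "lam_inf + \<epsilon> < H" "lam_inf + \<epsilon> + gam_inf < H"
    using \<epsilon> by (auto simp: \<epsilon>_def max_def field_simps)
  \<comment> \<open>The radius obtained exceeds \<open>t\<close>, hence also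
    \<open>R\<close>.\<close>
  from mu_add_far_inverse_square[OF N3 K mu_pos t(2) this[unfolded H_def]] show ?thesis
    using t(1) by (meson le_less_trans)
qed

end
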